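(* Let $N$ be a supernatural number, $n\in\mathbb Z$, and let $d:\mathcal A(N)\to A(N)$ be an $n$-covariant derivation in $A(N)$. Then there exists a (possibly unbounded) diagonal operator $\beta_n(\mathbb K)$ such that for all $a\in\mathcal A(N)$ $$d(a)=\begin{cases}[U^n\beta_n(\mathbb K),a]& \text{if } n\ge0,\\ [\beta_n(\mathbb K)(U^* )^{-n},a]&\text{if } n<0,\end{cases}\qquad(\ast)$$ where $\beta_n(\mathbb K)$ satisfies the following: if $N$ is infinite and $n\neq0$, or $N$ is finite and $N\nmid n$, then $\beta_n(\mathbb K)\in A_{\mathrm{diag}}(N)$ (so in particular it is bounded); otherwise $$\beta_n(\mathbb K)-\beta_n(\mathbb K-I)\in A_{\mathrm{diag}}(N).$$ The operator $\beta_n(\mathbb K)$ is unique except when $n=0$, in which case $\beta_0(\mathbb K)$ is unique up to an additive constant. Conversely, given any $\beta_n(\mathbb K)$ satisfying these properties, the formulas $(\ast)$ define an $n$-covariant derivation in $A(N)$.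
   Context: A supernatural number is a formal product $N=\prod_{p\text{ prime}}p^{\epsilon_p}$ with $\epsilon_p\in\{0,1,\dots,\infty\}$; it is finite (an ordinary positive integer) if $\sum_p\epsilon_p<\infty$, and infinite otherwise. A positive integer $j$ divides $N$ ($j\mid N$) if for each prime $p$ the exponent of $p$ in $j$ is at most $\epsilon_p$. On $\ell^2(\mathbb Z_{\ge0})$ with canonical basis $\{E_k\}_{k\ge 0}$ let $UE_k=E_{k+1}$ be the unilateral shift, $\mathbb KE_k=kE_k$, and for a sequence $a(k)$ let $a(\mathbb K)E_k=a(k)E_k$ (a diagonal operator). Convention: $a(-1)=0$, so $a(\mathbb K-I)E_k=a(k-1)E_k$ for $k\ge1$ and $a(\mathbb K-I)E_0=0$. Let $\mathcal A_{\mathrm{diag,per}}(N)=\{a(\mathbb K): a \text{ is } j\text{-periodic for some positive integer } j\mid N\}$. $A(N)$ is the C$^*$-algebra on $\ell^2(\mathbb Z_{\ge0})$ generated by $U$ and $\mathcal A_{\mathrm{diag,per}}(N)$; $\mathcal A(N)$ is the $^*$-subalgebra generated algebraically by $U,U^*,\mathcal A_{\mathrm{diag,per}}(N)$; $A_{\mathrm{diag}}(N)$ is the set of operators in $A(N)$ that are diagonal with respect to $\{E_k\}$. A derivation in $A(N)$ is a linear map $d:\mathcal A(N)\to A(N)$ with $d(ab)=d(a)b+a\,d(b)$. Let $\rho_\theta(a)=e^{i\theta\mathbb K}ae^{-i\theta\mathbb K}$, an automorphism of $A(N)$ preserving $\mathcal A(N)$. $d$ is $n$-covariant if $\rho_\theta^{-1}(d(\rho_\theta(a)))=e^{-in\theta}d(a)$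 for all $\theta\in[0,2\pi)$, $a\in\mathcal A(N)$. Commutators with unbounded diagonal operators are computed on the linear span of $\{E_k\}$ (which $\mathcal A(N)$ preserves) and then extended to bounded operators. *)

theory Defs
  imports "HOL-Analysis.Analysis" "HOL-Computational_Algebra.Primes" "HOL-Library.Extended_Nat"
begin

section \<open>The Hilbert space of square-summable sequences\<close>

typedef ell2 = "{x :: nat \<Rightarrow> complex. summable (\<lambda>k. (cmod (x k))\<^sup>2)}"
  morphisms coord Abs_ell2
  by (rule exI[of _ "\<lambda>_. 0"]) simp

lemma summable_coord: "summable (\<lambda>k. (cmod (coord x k))\<^sup>2)"
  using coord[of x] by simp

lemma coord_Abs_ell2: "summable (\<lambda>k. (cmod (f k))\<^sup>2) \<Longrightarrow> coord (Abs_ell2 f) = f"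
  by (simp add: Abs_ell2_inverse)

lemma ell2_eqI: "(\<And>k. coord x k = coord y k) \<Longrightarrow> x = y"
  by (metis coord_inject ext)

lemma summable_sq_add:
  fixes f g :: "nat \<Rightarrow> complex"
  assumes "summable (\<lambda>k. (cmod (f k))\<^sup>2)" "summable (\<lambda>k. (cmod (g k))\<^sup>2)"
  shows "summable (\<lambda>k. (cmod (f k + g k))\<^sup>2)"
proof (rule summable_comparison_test'[where N = 0])
  show "summable (\<lambda>k. 2 * (cmod (f k))\<^sup>2 + 2 * (cmod (g k))\<^sup>2)"
    by (intro summable_add summable_mult assms)
  fix k
  have "(cmod (f k + g k))\<^sup>2 \<le> (cmod (f k) + cmod (g k))\<^sup>2"
    by (intro power_mono norm_triangle_ineq) simp
  also have "\<dots> \<le> 2 * (cmod (f k))\<^sup>2 + 2 * (cmod (g k))\<^sup>2"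
    using sum_squares_bound[of "cmod (f k)" "cmod (g k)"]
    by (simp add: power2_sum)
  finally show "norm ((cmod (f k + g k))\<^sup>2) \<le> 2 * (cmod (f k))\<^sup>2 + 2 * (cmod (g k))\<^sup>2"
    by simp
qed

lemma summable_sq_bounded_mult:
  fixes f g :: "nat \<Rightarrow> complex"
  assumes "summable (\<lambda>k. (cmod (g k))\<^sup>2)" "\<And>k. cmod (f k) \<le> B"
  shows "summable (\<lambda>k. (cmod (f k * g k))\<^sup>2)"
proof (rule summable_comparison_test'[where N = 0])
  show "summable (\<lambda>k. B\<^sup>2 * (cmod (g k))\<^sup>2)"
    by (intro summable_mult assms)
  fix k
  show "norm ((cmod (f k * g k))\<^sup>2) \<le> B\<^sup>2 * (cmod (g k))\<^sup>2"
    using assms(2)[of k] by (simp add: norm_mult power_mult_distrib mult_right_mono power_mono)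
qed

lemma summable_sq_mult:
  fixes f :: "nat \<Rightarrow> complex"
  assumes "summable (\<lambda>k. (cmod (f k))\<^sup>2)"
  shows "summable (\<lambda>k. (cmod (c * f k))\<^sup>2)"
  by (rule summable_sq_bounded_mult[OF assms, of _ "cmod c"]) simp

lemma summable_cinner: "summable (\<lambda>k. coord x k * cnj (coord y k))"
proof (rule summable_comparison_test'[where N = 0])
  show "summable (\<lambda>k. (cmod (coord x k))\<^sup>2 + (cmod (coord y k))\<^sup>2)"
    by (intro summable_add summable_coord)
  fix k
  have "cmod (coord x k) * cmod (coord y k) \<ge> 0" by simp
  then have "cmod (coord x k) * cmod (coord y k) \<le> (cmod (coord x k))\<^sup>2 + (cmod (coord y k))\<^sup>2"
    using sum_squares_bound[of "cmod (coord x k)" "cmod (coord y k)"] by linarith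
  then show "norm (coord x k * cnj (coord y k)) \<le> (cmod (coord x k))\<^sup>2 + (cmod (coord y k))\<^sup>2"
    by (simp add: norm_mult)
qed

definition cinner :: "ell2 \<Rightarrow> ell2 \<Rightarrow> complex" where
  "cinner x y = (\<Sum>k. coord x k * cnj (coord y k))"

definition scaleC :: "complex \<Rightarrow> ell2 \<Rightarrow> ell2"  (infixr \<open>*\<^sub>C\<close> 75) where
  "c *\<^sub>C x = Abs_ell2 (\<lambda>k. c * coord x k)"

lemma coord_scaleC: "coord (c *\<^sub>C x) k = c * coord x k"
  unfolding scaleC_def by (simp add: coord_Abs_ell2 summable_sq_mult summable_coord)

text \<open>The underlying real inner product is the real part of \<^const>\<open>cinner\<close>; the norm it
  induces is the Hilbert space norm.\<close>

instantiation ell2 :: real_inner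
begin

definition zero_ell2 :: ell2 where "0 = Abs_ell2 (\<lambda>_. 0)"
definition plus_ell2 :: "ell2 \<Rightarrow> ell2 \<Rightarrow> ell2" where
  "x + y = Abs_ell2 (\<lambda>k. coord x k + coord y k)"
definition uminus_ell2 :: "ell2 \<Rightarrow> ell2" where "- x = (- 1) *\<^sub>C x"
definition minus_ell2 :: "ell2 \<Rightarrow> ell2 \<Rightarrow> ell2" where "x - y = x + (- (y :: ell2))"
definition scaleR_ell2 :: "real \<Rightarrow> ell2 \<Rightarrow> ell2" where "r *\<^sub>R x = complex_of_real r *\<^sub>C x"
definition inner_ell2 :: "ell2 \<Rightarrow> ell2 \<Rightarrow> real" where "inner x y = Re (cinner x y)"
definition norm_ell2 :: "ell2 \<Rightarrow> real" where "norm x = sqrt (inner x (x :: ell2))"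
definition sgn_ell2 :: "ell2 \<Rightarrow> ell2" where "sgn x = inverse (norm x) *\<^sub>R (x :: ell2)"
definition dist_ell2 :: "ell2 \<Rightarrow> ell2 \<Rightarrow> real" where "dist x y = norm (x - (y :: ell2))"
definition uniformity_ell2 :: "(ell2 \<times> ell2) filter" where
  "uniformity = (INF e\<in>{0 <..}. principal {(x, y :: ell2). dist x y < e})"
definition open_ell2 :: "ell2 set \<Rightarrow> bool" where
  "open S = (\<forall>x\<in>S. \<forall>\<^sub>F (x', y) in uniformity. x' = x \<longrightarrow> (y :: ell2) \<in> S)"

lemma coord_zero: "coord 0 k = 0"
  by (simp add: zero_ell2_def coord_Abs_ell2)
lemma coord_add: "coord (x + y) k = coord x k + coord y k"
  by (simp add: plus_ell2_def coord_Abs_ell2 summable_sq_add summable_coord)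
lemma coord_uminus: "coord (- x) k = - coord x k"
  by (simp add: uminus_ell2_def coord_scaleC)
lemma coord_minus: "coord (x - y) k = coord x k - coord y k"
  by (simp add: minus_ell2_def coord_add coord_uminus)
lemma coord_scaleR: "coord (r *\<^sub>R x) k = complex_of_real r * coord x k"
  by (simp add: scaleR_ell2_def coord_scaleC)

lemma cinner_add_left: "cinner (x + y) z = cinner x z + cinner y z"
  by (simp add: cinner_def coord_add distrib_right suminf_add[symmetric] summable_cinner)
lemma cinner_scaleC_left: "cinner (c *\<^sub>C x) y = c * cinner x y"
  by (simp add: cinner_def coord_scaleC mult.assoc suminf_mult summable_cinner)
lemma cinner_commute: "cinner x y = cnj (cinner y x)"
proof -
  have "(\<lambda>k. coord y k * cnj (coord x k)) sums cinner y x"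
    unfolding cinner_def by (rule summable_sums[OF summable_cinner])
  then have "(\<lambda>k. cnj (coord y k * cnj (coord x k))) sums cnj (cinner y x)"
    by (simp only: sums_cnj)
  then have "(\<lambda>k. coord x k * cnj (coord y k)) sums cnj (cinner y x)"
    by (simp add: mult.commute)
  then show ?thesis
    by (metis cinner_def sums_unique)
qed

lemma inner_self_ell2: "inner x x = (\<Sum>k. (cmod (coord x k))\<^sup>2)" for x :: ell2
proof -
  have "cinner x x = (\<Sum>k. complex_of_real ((cmod (coord x k))\<^sup>2))"
    unfolding cinner_def by (simp only: complex_norm_square)
  then show ?thesis
    by (simp only: inner_ell2_def suminf_of_real[OF summable_coord, symmetric] Re_complex_of_real)
qed

instance
proof
  fix x y z :: ell2 and r s :: real
  show "x + y + z = x + (y + z)" "x + y = y + x" "0 + x = x" "- x + x = 0" "x - y = x + - y"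
    by (auto intro!: ell2_eqI simp: coord_add coord_zero coord_uminus coord_minus)
  show "r *\<^sub>R (x + y) = r *\<^sub>R x + r *\<^sub>R y" "(r + s) *\<^sub>R x = r *\<^sub>R x + s *\<^sub>R x"
    "r *\<^sub>R s *\<^sub>R x = (r * s) *\<^sub>R x" "1 *\<^sub>R x = x"
    by (auto intro!: ell2_eqI simp: coord_add coord_scaleR algebra_simps)
  show "dist x y = norm (x - y)" by (rule dist_ell2_def)
  show "sgn x = inverse (norm x) *\<^sub>R x" by (rule sgn_ell2_def)
  show "uniformity = (INF e\<in>{0 <..}. principal {(x, y :: ell2). dist x y < e})"
    by (rule uniformity_ell2_def)
  show "open U = (\<forall>x\<in>U. \<forall>\<^sub>F (x', y) in uniformity. x' = x \<longrightarrow> y \<in> U)" for U :: "ell2 set"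
    by (rule open_ell2_def)
  show "inner x y = inner y x"
    unfolding inner_ell2_def by (subst cinner_commute) simp
  show "inner (x + y) z = inner x z + inner y z"
    by (simp add: inner_ell2_def cinner_add_left)
  show "inner (r *\<^sub>R x) y = r * inner x y"
    by (simp add: inner_ell2_def scaleR_ell2_def cinner_scaleC_left)
  show "0 \<le> inner x x"
    by (simp add: inner_self_ell2 suminf_nonneg summable_coord)
  show "inner x x = 0 \<longleftrightarrow> x = 0"
  proof -
    have "inner x x = 0 \<longleftrightarrow> (\<forall>k. coord x k = 0)"
      by (simp add: inner_self_ell2 suminf_eq_zero_iff summable_coord)
    also have "\<dots> \<longleftrightarrow> x = 0"
      by (metis coord_zero ell2_eqI)
    finally show ?thesis .
  qed
  show "norm x = sqrt (inner x x)" by (rule norm_ell2_def)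
qed

end

lemma norm_ell2_eq: "norm x = sqrt (\<Sum>k. (cmod (coord x k))\<^sup>2)" for x :: ell2
  by (simp add: norm_ell2_def inner_self_ell2)

lemma norm_ell2_le:
  fixes x y :: ell2
  assumes "\<And>k. cmod (coord x k) \<le> B * cmod (coord y k)" "B \<ge> 0"
  shows "norm x \<le> B * norm y"
proof -
  have "(\<Sum>k. (cmod (coord x k))\<^sup>2) \<le> (\<Sum>k. B\<^sup>2 * (cmod (coord y k))\<^sup>2)"
    using assms by (intro suminf_le summable_coord summable_mult)
      (metis norm_ge_zero power_mono power_mult_distrib)
  also have "\<dots> = B\<^sup>2 * (\<Sum>k. (cmod (coord y k))\<^sup>2)"
    by (simp add: suminf_mult summable_coord)
  finally show ?thesis
    using assms(2) by (simp add: norm_ell2_eq real_le_lsqrt real_sqrt_mult real_sqrt_le_iff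
        flip: real_sqrt_mult real_sqrt_abs) (metis real_sqrt_abs real_sqrt_le_mono real_sqrt_mult abs_of_nonneg)
qed

definition basis_vec :: "nat \<Rightarrow> ell2" where
  "basis_vec k = Abs_ell2 (\<lambda>i. if i = k then 1 else 0)"

lemma coord_basis_vec: "coord (basis_vec k) i = (if i = k then 1 else 0)"
proof -
  have "summable (\<lambda>i. (cmod (if i = k then 1 else 0))\<^sup>2)"
    by (rule summable_finite[of "{k}"]) auto
  then show ?thesis by (simp add: basis_vec_def coord_Abs_ell2)
qed

definition basis_span :: "ell2 set" where
  "basis_span = {x. \<exists>F c. finite F \<and> x = (\<Sum>k\<in>F. c k *\<^sub>C basis_vec k)}"


section \<open>Bounded operators\<close>

text \<open>The type of bounded linear functions of the library is real linear; the bounded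
  operators on the Hilbert space are its complex linear elements.\<close>

type_synonym operator = "ell2 \<Rightarrow>\<^sub>L ell2"

definition bounded_operators :: "operator set" where
  "bounded_operators =
     {T. \<forall>c x. blinfun_apply T (c *\<^sub>C x) = c *\<^sub>C blinfun_apply T x}"

definition scaleC_op :: "complex \<Rightarrow> operator \<Rightarrow> operator" where
  "scaleC_op c T = Blinfun (\<lambda>x. c *\<^sub>C blinfun_apply T x)"

definition is_adjoint :: "operator \<Rightarrow> operator \<Rightarrow> bool" where
  "is_adjoint S T \<longleftrightarrow>
     (\<forall>x y. cinner (blinfun_apply S x) y = cinner x (blinfun_apply T y))"

definition adj :: "operator \<Rightarrow> operator" where
  "adj T = (THE S. is_adjoint S T)"

definition shift :: operator where
  "shift = Blinfun (\<lambda>x. Abs_ell2 (\<lambda>k. case k of 0 \<Rightarrow> 0 | Suc i \<Rightarrow> coord x i))"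

text \<open>The diagonal operator with eigenvalue sequence \<open>a\<close>, on its maximal domain; outside
  that domain the value is the dummy \<open>0\<close>. For unbounded \<open>a\<close> it is only ever applied to
  vectors in \<^const>\<open>basis_span\<close>.\<close>

definition diag_op :: "(nat \<Rightarrow> complex) \<Rightarrow> ell2 \<Rightarrow> ell2" where
  "diag_op a x = (if summable (\<lambda>k. (cmod (a k * coord x k))\<^sup>2)
                  then Abs_ell2 (\<lambda>k. a k * coord x k) else 0)"

text \<open>The diagonal operator of a bounded sequence; the value for unbounded sequences is
  meaningless.\<close>

definition bdiag :: "(nat \<Rightarrow> complex) \<Rightarrow> operator" where
  "bdiag a = Blinfun (diag_op a)"

lemma coord_diag_op_bounded:
  assumes "\<And>k. cmod (a k) \<le> B"
  shows "coord (diag_op a x) k = a k * coord x k"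
  using summable_sq_bounded_mult[OF summable_coord[of x], of a B, OF assms]
  by (simp add: diag_op_def coord_Abs_ell2)

lemma blinfun_apply_bdiag:
  assumes "\<And>k. cmod (a k) \<le> B"
  shows "blinfun_apply (bdiag a) = diag_op a"
  unfolding bdiag_def
proof (rule bounded_linear_Blinfun_apply, rule bounded_linear_intro[where K = B])
  note c = coord_diag_op_bounded[of a B, OF assms]
  fix x y r
  show "diag_op a (x + y) = diag_op a x + diag_op a y"
    by (rule ell2_eqI) (simp add: c coord_add algebra_simps)
  show "diag_op a (r *\<^sub>R x) = r *\<^sub>R diag_op a x"
    by (rule ell2_eqI) (simp add: c coord_scaleR algebra_simps)
  have "B \<ge> 0" using assms[of 0] norm_ge_zero order_trans by blast
  then show "norm (diag_op a x) \<le> norm x * B"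
    using norm_ell2_le[of "diag_op a x" B x] assms
    by (simp add: c norm_mult mult_right_mono mult.commute)
qed

lemma diag_op_basis_vec: "diag_op a (basis_vec k) = a k *\<^sub>C basis_vec k"
proof (rule ell2_eqI)
  fix i
  have "summable (\<lambda>i. (cmod (a i * coord (basis_vec k) i))\<^sup>2)"
    by (rule summable_finite[of "{k}"]) (auto simp: coord_basis_vec)
  then show "coord (diag_op a (basis_vec k)) i = coord (a k *\<^sub>C basis_vec k) i"
    by (simp add: diag_op_def coord_Abs_ell2 coord_basis_vec coord_scaleC)
qed

lemma coord_shift:
  "coord (blinfun_apply shift x) k = (case k of 0 \<Rightarrow> 0 | Suc i \<Rightarrow> coord x i)"
proof -
  let ?S = "\<lambda>x. Abs_ell2 (\<lambda>k. case k of 0 \<Rightarrow> 0 | Suc i \<Rightarrow> coord x i)"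
  have s: "summable (\<lambda>k. (cmod (case k of 0 \<Rightarrow> 0 | Suc i \<Rightarrow> coord x i))\<^sup>2)" for x
    by (subst summable_Suc_iff[symmetric]) (simp add: summable_coord)
  have c: "coord (?S x) k = (case k of 0 \<Rightarrow> 0 | Suc i \<Rightarrow> coord x i)" for x k
    by (simp add: coord_Abs_ell2 s)
  have n: "norm (?S x) = norm x" for x
    using suminf_split_head[OF s[of x]] by (simp add: norm_ell2_eq c)
  have "bounded_linear ?S"
  proof (rule bounded_linear_intro[where K = 1])
    fix x y r
    show "?S (x + y) = ?S x + ?S y"
      by (rule ell2_eqI) (simp add: c coord_add split: nat.split)
    show "?S (r *\<^sub>R x) = r *\<^sub>R ?S x"
      by (rule ell2_eqI) (simp add: c coord_scaleR split: nat.split)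
    show "norm (?S x) \<le> norm x * 1" by (simp add: n)
  qed
  then show ?thesis
    unfolding shift_def by (simp add: bounded_linear_Blinfun_apply c)
qed

lemma shift_basis_vec: "blinfun_apply shift (basis_vec k) = basis_vec (Suc k)"
  by (rule ell2_eqI) (simp add: coord_shift coord_basis_vec split: nat.split)

lemma blinfun_apply_scaleC_op: "blinfun_apply (scaleC_op c T) x = c *\<^sub>C blinfun_apply T x"
proof -
  have "diag_op (\<lambda>_. c) y = c *\<^sub>C y" for y
    by (rule ell2_eqI) (simp add: coord_diag_op_bounded[of _ "cmod c"] coord_scaleC)
  then have "blinfun_apply (bdiag (\<lambda>_. c)) y = c *\<^sub>C y" for y
    by (simp add: blinfun_apply_bdiag[of "\<lambda>_. c" "cmod c"])
  then have "(\<lambda>x. c *\<^sub>C blinfun_apply T x) = blinfun_apply (bdiag (\<lambda>_. c) o\<^sub>L T)"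
    by auto
  then show ?thesis
    unfolding scaleC_op_def
    by (metis bounded_linear_Blinfun_apply blinfun.bounded_linear_right)
qed

lemma bounded_periodic:
  fixes a :: "nat \<Rightarrow> complex"
  assumes "j > 0" "\<forall>k. a (k + j) = a k"
  shows "\<exists>B. \<forall>k. cmod (a k) \<le> B"
proof -
  have mult: "a (k + m * j) = a k" for k m
    using assms(2) by (induction m) (auto simp: algebra_simps, metis add.assoc add.commute)
  have "a k = a (k mod j)" for k
    using mult[of "k mod j" "k div j"] by simp
  moreover have "cmod (a (k mod j)) \<le> Max ((\<lambda>i. cmod (a i)) ` {..<j})" for k
    using assms(1) by (intro Max_ge) auto
  ultimately show ?thesis by metis
qed

lemma cinner_basis_vec: "cinner x (basis_vec k) = coord x k"
proof -
  have "(\<lambda>i. coord x i * cnj (coord (basis_vec k) i)) sums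
      (\<Sum>i\<in>{k}. coord x i * cnj (coord (basis_vec k) i))"
    by (rule sums_finite) (auto simp: coord_basis_vec)
  then show ?thesis by (simp add: cinner_def coord_basis_vec sums_unique[symmetric])
qed

lemma bounded_operators_sum: "blinfun_apply T (\<Sum>k\<in>F. c k *\<^sub>C f k) =
    (\<Sum>k\<in>F. c k *\<^sub>C blinfun_apply T (f k))" if "T \<in> bounded_operators"
  using that by (simp add: bounded_operators_def blinfun.sum_right)

lemma cinner_add_right: "cinner z (x + y) = cinner z x + cinner z y"
  by (metis cinner_add_left cinner_commute complex_cnj_add)

lemma cinner_scaleC_right: "cinner x (c *\<^sub>C y) = cnj c * cinner x y"
  by (metis cinner_commute cinner_scaleC_left complex_cnj_mult)

lemma cinner_sum_right: "cinner x (\<Sum>k\<in>F. f k) = (\<Sum>k\<in>F. cinner x (f k))"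
proof (induction F rule: infinite_finite_induct)
  have zero: "cinner x 0 = 0"
    by (simp add: cinner_def coord_zero)
  {
    case (infinite A)
    then show ?case by (simp add: zero)
  next
    case empty
    then show ?case by (simp add: zero)
  next
    case (insert k F)
    then show ?case by (simp add: cinner_add_right)
  }
qed

lemma coord_sum: "coord (\<Sum>k\<in>F. f k) i = (\<Sum>k\<in>F. coord (f k) i)"
  by (induction F rule: infinite_finite_induct) (simp_all add: coord_zero coord_add)

lemma cinner_eq_inner: "cinner x y = Complex (inner x y) (inner x (\<i> *\<^sub>C y))"
  by (simp add: inner_ell2_def cinner_scaleC_right complex_eq_iff)

definition trunc :: "nat \<Rightarrow> (nat \<Rightarrow> complex) \<Rightarrow> ell2" where
  "trunc n c = (\<Sum>k<n. c k *\<^sub>C basis_vec k)"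

lemma coord_trunc: "coord (trunc n c) i = (if i < n then c i else 0)"
  by (simp add: trunc_def coord_sum coord_scaleC coord_basis_vec if_distrib cong: if_cong)

lemma norm_trunc: "(norm (trunc n c))\<^sup>2 = (\<Sum>k<n. (cmod (c k))\<^sup>2)"
proof -
  have "(\<lambda>k. (cmod (coord (trunc n c) k))\<^sup>2) sums
      (\<Sum>k<n. (cmod (coord (trunc n c) k))\<^sup>2)"
    by (rule sums_finite) (auto simp: coord_trunc)
  then have "inner (trunc n c) (trunc n c) = (\<Sum>k<n. (cmod (c k))\<^sup>2)"
    by (simp add: inner_self_ell2 sums_unique[symmetric] coord_trunc)
  then show ?thesis by (simp add: power2_norm_eq_inner)
qed

lemma tendsto_trunc: "(\<lambda>n. trunc n (coord x)) \<longlonglongrightarrow> x"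
proof -
  let ?f = "\<lambda>k. (cmod (coord x k))\<^sup>2"
  have "(norm (trunc n (coord x) - x))\<^sup>2 = suminf ?f - (\<Sum>k<n. ?f k)" for n
  proof -
    have "(\<lambda>k. if k < n then ?f k else 0) sums (\<Sum>k<n. if k < n then ?f k else 0)"
      by (rule sums_finite) auto
    then have "(\<lambda>k. ?f k - (if k < n then ?f k else 0)) sums (suminf ?f - (\<Sum>k<n. ?f k))"
      using sums_diff[OF summable_sums[OF summable_coord[of x]]] by simp
    moreover have "(\<lambda>k. ?f k - (if k < n then ?f k else 0)) =
        (\<lambda>k. (cmod (coord (trunc n (coord x) - x) k))\<^sup>2)"
      by (auto simp: coord_minus coord_trunc)
    ultimately show ?thesis
      by (simp add: power2_norm_eq_inner inner_self_ell2 sums_unique[symmetric])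
  qed
  moreover have "(\<lambda>n. suminf ?f - (\<Sum>k<n. ?f k)) \<longlonglongrightarrow> suminf ?f - suminf ?f"
    by (intro tendsto_diff tendsto_const summable_LIMSEQ summable_coord)
  ultimately have "(\<lambda>n. (norm (trunc n (coord x) - x))\<^sup>2) \<longlonglongrightarrow> 0"
    by simp
  then have "(\<lambda>n. sqrt ((norm (trunc n (coord x) - x))\<^sup>2)) \<longlonglongrightarrow> sqrt 0"
    by (rule tendsto_real_sqrt)
  then show ?thesis
    by (simp add: LIM_zero_iff tendsto_norm_zero_iff)
qed

lemma adj_eqI:
  assumes "is_adjoint S T"
  shows "adj T = S"
  unfolding adj_def
proof (rule the_equality[where P = "\<lambda>S. is_adjoint S T", OF assms])
  fix R assume "is_adjoint R T"
  with assms have "coord (blinfun_apply R x) k = coord (blinfun_apply S x) k" for x k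
    by (metis is_adjoint_def cinner_basis_vec)
  then show "R = S" by (intro blinfun_eqI ell2_eqI)
qed

lemma is_adjoint_adj:
  assumes T: "T \<in> bounded_operators"
  shows "is_adjoint (adj T) T"
proof -
  define c where "c x k = cinner x (blinfun_apply T (basis_vec k))" for x k
  have cin: "cinner x (blinfun_apply T (trunc n b)) = (\<Sum>k<n. cnj (b k) * c x k)" for x n b
    by (simp add: trunc_def bounded_operators_sum[OF T] cinner_sum_right cinner_scaleC_right c_def)
  have bound: "(\<Sum>k<n. (cmod (c x k))\<^sup>2) \<le> (norm x * norm T)\<^sup>2" for x n
  proof -
    let ?s = "\<Sum>k<n. (cmod (c x k))\<^sup>2"
    have "inner x (blinfun_apply T (trunc n (c x))) = Re (\<Sum>k<n. complex_of_real ((cmod (c x k))\<^sup>2))"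
      unfolding inner_ell2_def cin by (simp only: complex_norm_square mult.commute)
    then have "?s = inner x (blinfun_apply T (trunc n (c x)))"
      by simp
    also have "\<dots> \<le> norm x * norm (blinfun_apply T (trunc n (c x)))"
      by (rule norm_cauchy_schwarz)
    also have "\<dots> \<le> norm x * (norm T * norm (trunc n (c x)))"
      by (intro mult_left_mono norm_blinfun) simp
    finally have le: "?s \<le> (norm x * norm T) * norm (trunc n (c x))"
      by (simp add: mult.assoc)
    have "norm (trunc n (c x)) \<le> norm x * norm T"
    proof (cases "norm (trunc n (c x)) = 0")
      case False
      then have "norm (trunc n (c x)) > 0" by simp
      moreover have "norm (trunc n (c x)) * norm (trunc n (c x))
          \<le> (norm x * norm T) * norm (trunc n (c x))"
        using le norm_trunc[of n "c x"] by (simp add: power2_eq_square)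
      ultimately show ?thesis by (metis mult_le_cancel_right_pos)
    qed simp
    then show ?thesis
      unfolding norm_trunc[symmetric] by (intro power_mono) auto
  qed
  have summable: "summable (\<lambda>k. (cmod (c x k))\<^sup>2)" for x
    by (rule bounded_imp_summable[where B = "(norm x * norm T)\<^sup>2"])
      (simp_all only: bound zero_le_power2 flip: lessThan_Suc_atMost)
  let ?S = "\<lambda>x. Abs_ell2 (c x)"
  have coord_S: "coord (?S x) k = c x k" for x k
    by (simp add: coord_Abs_ell2 summable)
  have lin: "bounded_linear ?S"
  proof (rule bounded_linear_intro[where K = "norm T"])
    fix x y r
    show "?S (x + y) = ?S x + ?S y"
      by (rule ell2_eqI) (simp only: coord_S coord_add c_def cinner_add_left)
    show "?S (r *\<^sub>R x) = r *\<^sub>R ?S x"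
      by (rule ell2_eqI) (simp only: coord_S coord_scaleR c_def cinner_scaleC_left scaleR_ell2_def coord_scaleC)
    have "(norm (?S x))\<^sup>2 \<le> (norm x * norm T)\<^sup>2"
      unfolding power2_norm_eq_inner[of "?S x"] inner_self_ell2 coord_S
      by (intro suminf_le_const summable bound)
    then show "norm (?S x) \<le> norm x * norm T"
      by (rule power2_le_imp_le) simp
  qed
  have inner_eq: "inner (?S x) y = inner x (blinfun_apply T y)" for x y
  proof (rule LIMSEQ_unique)
    show "(\<lambda>n. inner (?S x) (trunc n (coord y))) \<longlonglongrightarrow> inner (?S x) y"
      by (intro tendsto_inner tendsto_const tendsto_trunc)
    have "cinner (?S x) (trunc n b) = cinner x (blinfun_apply T (trunc n b))" for n b
      unfolding cin
      by (simp add: trunc_def cinner_sum_right cinner_scaleC_right cinner_basis_vec coord_S)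
    then have "inner (?S x) (trunc n b) = inner x (blinfun_apply T (trunc n b))" for n b
      by (simp add: inner_ell2_def)
    then show "(\<lambda>n. inner (?S x) (trunc n (coord y))) \<longlonglongrightarrow> inner x (blinfun_apply T y)"
      by (simp only:) (intro tendsto_inner tendsto_const blinfun.tendsto tendsto_trunc)
  qed
  have "is_adjoint (Blinfun ?S) T"
    unfolding is_adjoint_def
  proof (intro allI)
    fix x y
    have "blinfun_apply T (\<i> *\<^sub>C y) = \<i> *\<^sub>C blinfun_apply T y"
      using T by (simp add: bounded_operators_def)
    then show "cinner (blinfun_apply (Blinfun ?S) x) y = cinner x (blinfun_apply T y)"
      by (metis cinner_eq_inner inner_eq bounded_linear_Blinfun_apply[OF lin])
  qed
  then show ?thesis using adj_eqI by metis
qed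


section \<open>Supernatural numbers\<close>

text \<open>A supernatural number is given by its exponents; only the values at primes matter.\<close>

type_synonym supernatural = "nat \<Rightarrow> enat"

definition finite_supernatural :: "supernatural \<Rightarrow> bool" where
  "finite_supernatural N \<longleftrightarrow>
     finite {p. prime p \<and> N p \<noteq> 0} \<and> (\<forall>p. prime p \<longrightarrow> N p \<noteq> \<infinity>)"

text \<open>The positive integer that a finite supernatural number stands for.\<close>

definition supernatural_value :: "supernatural \<Rightarrow> nat" where
  "supernatural_value N = (\<Prod>p | prime p \<and> N p \<noteq> 0. p ^ the_enat (N p))"

definition dvd_supernatural :: "nat \<Rightarrow> supernatural \<Rightarrow> bool" where
  "dvd_supernatural j N \<longleftrightarrow> (\<forall>p. prime p \<longrightarrow> enat (multiplicity p j) \<le> N p)"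


section \<open>The algebras\<close>

definition star_subalgebra :: "operator set \<Rightarrow> bool" where
  "star_subalgebra B \<longleftrightarrow> B \<subseteq> bounded_operators \<and> 0 \<in> B \<and>
     (\<forall>S\<in>B. \<forall>T\<in>B. S + T \<in> B) \<and> (\<forall>c. \<forall>T\<in>B. scaleC_op c T \<in> B) \<and>
     (\<forall>S\<in>B. \<forall>T\<in>B. S o\<^sub>L T \<in> B) \<and> (\<forall>T\<in>B. adj T \<in> B)"

definition A_diag_per :: "supernatural \<Rightarrow> operator set" where
  "A_diag_per N = {bdiag a | a. \<exists>j>0. dvd_supernatural j N \<and> (\<forall>k. a (k + j) = a k)}"

definition A_alg :: "supernatural \<Rightarrow> operator set" where
  "A_alg N = star_subalgebra hull (insert shift (A_diag_per N))"

definition A_cstar :: "supernatural \<Rightarrow> operator set" where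
  "A_cstar N = (\<lambda>B. star_subalgebra B \<and> closed B) hull (insert shift (A_diag_per N))"

definition A_diag :: "supernatural \<Rightarrow> operator set" where
  "A_diag N = {T \<in> A_cstar N.
     \<exists>a. \<forall>k. blinfun_apply T (basis_vec k) = a k *\<^sub>C basis_vec k}"

text \<open>\<open>\<beta>(\<bbbK>)\<close> is (bounded and) an element of \<^const>\<open>A_diag\<close>.\<close>

definition diag_mem :: "supernatural \<Rightarrow> (nat \<Rightarrow> complex) \<Rightarrow> bool" where
  "diag_mem N \<beta> \<longleftrightarrow>
     (\<exists>T\<in>A_diag N. \<forall>k. blinfun_apply T (basis_vec k) = \<beta> k *\<^sub>C basis_vec k)"


section \<open>Covariant derivations\<close>

text \<open>Only the values on \<^const>\<open>A_alg\<close> matter, so \<open>d\<close> is a total function that is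
  unconstrained elsewhere.\<close>

definition derivation_in :: "supernatural \<Rightarrow> (operator \<Rightarrow> operator) \<Rightarrow> bool" where
  "derivation_in N d \<longleftrightarrow>
     (\<forall>a\<in>A_alg N. d a \<in> A_cstar N) \<and>
     (\<forall>a\<in>A_alg N. \<forall>b\<in>A_alg N. d (a + b) = d a + d b) \<and>
     (\<forall>c. \<forall>a\<in>A_alg N. d (scaleC_op c a) = scaleC_op c (d a)) \<and>
     (\<forall>a\<in>A_alg N. \<forall>b\<in>A_alg N. d (a o\<^sub>L b) = (d a o\<^sub>L b) + (a o\<^sub>L d b))"

definition rho :: "real \<Rightarrow> operator \<Rightarrow> operator" where
  "rho \<theta> a = bdiag (\<lambda>k. cis (\<theta> * k)) o\<^sub>L a o\<^sub>L bdiag (\<lambda>k. cis (- (\<theta> * k)))"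

lemma bdiag_mult:
  assumes "\<And>k. cmod (a k) \<le> B" "\<And>k. cmod (b k) \<le> C"
  shows "bdiag a o\<^sub>L bdiag b = bdiag (\<lambda>k. a k * b k)"
proof (intro blinfun_eqI ell2_eqI)
  fix x k
  have "B \<ge> 0" using assms(1)[of 0] norm_ge_zero order_trans by blast
  then have "cmod (a k * b k) \<le> B * C" for k
    using assms by (simp add: norm_mult mult_mono)
  then show "coord (blinfun_apply (bdiag a o\<^sub>L bdiag b) x) k =
      coord (blinfun_apply (bdiag (\<lambda>k. a k * b k)) x) k"
    by (simp add: blinfun_apply_bdiag[OF assms(1)] blinfun_apply_bdiag[OF assms(2)]
        blinfun_apply_bdiag[of _ "B * C"] coord_diag_op_bounded[OF assms(1)]
        coord_diag_op_bounded[OF assms(2)] coord_diag_op_bounded[of _ "B * C"])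
qed

lemma bdiag_one: "bdiag (\<lambda>_. 1) = id_blinfun"
  by (intro blinfun_eqI ell2_eqI)
    (simp add: blinfun_apply_bdiag[of _ 1] coord_diag_op_bounded[of _ 1])

lemma rho_minus_rho: "rho (- \<theta>) (rho \<theta> a) = a"
proof -
  let ?V = "bdiag (\<lambda>k. cis (\<theta> * k))" and ?W = "bdiag (\<lambda>k. cis (- (\<theta> * k)))"
  have WV: "?W o\<^sub>L ?V = id_blinfun"
    by (simp add: bdiag_mult[of _ 1 _ 1] cis_mult bdiag_one)
  have "rho (- \<theta>) (rho \<theta> a) = (?W o\<^sub>L ?V) o\<^sub>L a o\<^sub>L (?W o\<^sub>L ?V)"
    by (simp add: rho_def blinfun_eqI)
  then show ?thesis
    unfolding WV by (simp add: blinfun_eqI)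
qed

text \<open>By the preceding lemma, \<open>rho (- \<theta>)\<close> is the inverse of \<open>rho \<theta>\<close>.\<close>

definition covariant :: "supernatural \<Rightarrow> int \<Rightarrow> (operator \<Rightarrow> operator) \<Rightarrow> bool" where
  "covariant N n d \<longleftrightarrow>
     (\<forall>\<theta>\<in>{0..<2 * pi}. \<forall>a\<in>A_alg N.
        rho (- \<theta>) (d (rho \<theta> a)) = scaleC_op (exp (- \<i> * of_int n * of_real \<theta>)) (d a))"

text \<open>\<open>U\<^sup>n \<beta>(\<bbbK>)\<close> for \<open>n \<ge> 0\<close> and \<open>\<beta>(\<bbbK>) (U\<^sup>*)\<^sup>-\<^sup>n\<close> for \<open>n < 0\<close>,
  as possibly unbounded operators.\<close>

definition twisted_diag :: "int \<Rightarrow> (nat \<Rightarrow> complex) \<Rightarrow> ell2 \<Rightarrow> ell2" where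
  "twisted_diag n \<beta> x =
     (if n \<ge> 0 then (blinfun_apply shift ^^ nat n) (diag_op \<beta> x)
      else diag_op \<beta> ((blinfun_apply (adj shift) ^^ nat (- n)) x))"

text \<open>The commutator is computed on \<^const>\<open>basis_span\<close>; as that is dense, this determines
  the bounded operator \<open>d a\<close>, which is the extension of the commutator.\<close>

definition implements :: "supernatural \<Rightarrow> int \<Rightarrow> (nat \<Rightarrow> complex) \<Rightarrow> (operator \<Rightarrow> operator) \<Rightarrow> bool"
  where
  "implements N n \<beta> d \<longleftrightarrow>
     (\<forall>a\<in>A_alg N. \<forall>x\<in>basis_span. blinfun_apply (d a) x =
        twisted_diag n \<beta> (blinfun_apply a x) - blinfun_apply a (twisted_diag n \<beta> x))"

text \<open>The eigenvalue sequence of \<open>\<beta>(\<bbbK>) - \<beta>(\<bbbK> - I)\<close>, with the convention \<open>\<beta>(-1) = 0\<close>.\<close>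

definition backward_diff :: "(nat \<Rightarrow> complex) \<Rightarrow> nat \<Rightarrow> complex" where
  "backward_diff \<beta> k = \<beta> k - (if k = 0 then 0 else \<beta> (k - 1))"

definition beta_condition :: "supernatural \<Rightarrow> int \<Rightarrow> (nat \<Rightarrow> complex) \<Rightarrow> bool" where
  "beta_condition N n \<beta> \<longleftrightarrow>
     (if (\<not> finite_supernatural N \<and> n \<noteq> 0) \<or>
         (finite_supernatural N \<and> \<not> int (supernatural_value N) dvd n)
      then diag_mem N \<beta> else diag_mem N (backward_diff \<beta>))"

end

theory Submission
  imports Defs "HOL-Library.Real_Mod"
begin

text \<open>The algebra contains the matrix units \<open>U\<^sup>i P\<close>, where \<open>P = I - U U\<^sup>*\<close> projects onto \<open>E\<^sub>0\<close>. As every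
  \<open>a\<close> in the polynomial algebra has finite columns, \<open>a U\<^sup>i P\<close> is the finite combination of the
  \<open>U\<^sup>k P\<close> with the entries of column \<open>i\<close> as coefficients; applying \<open>d\<close> and evaluating at \<open>E\<^sub>0\<close> gives
  \<open>d a = [B, a]\<close> for \<open>B E\<^sub>i = d (U\<^sup>i P) E\<^sub>0\<close>, and covariance forces \<open>B E\<^sub>i\<close> to be a multiple of
  \<open>E\<^sub>i\<^sub>+\<^sub>n\<close>. The condition on \<open>\<beta>\<close> is read off from \<open>[B, U]\<close> and, if some \<open>j\<close> dividing \<open>N\<close> does not
  divide \<open>n\<close>, from \<open>[B, \<omega>\<^sup>\<bbbK>]\<close> with \<open>\<omega>\<close> a primitive \<open>j\<close>-th root of unity. Conversely, either
  \<open>B\<close> lies in the C*-algebra, or \<open>j\<close> divides \<open>n\<close> for all \<open>j\<close> dividing \<open>N\<close>, so that \<open>B\<close> commutes with the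
  periodic diagonal operators and \<open>[B, U]\<close>, \<open>[B, U\<^sup>*]\<close> are products of \<open>U\<close>, \<open>U\<^sup>*\<close> and
  \<open>\<beta>(\<bbbK>) - \<beta>(\<bbbK> - I)\<close>.\<close>

section \<open>Finitely supported vectors\<close>

lemma basis_span_iff: "x \<in> basis_span \<longleftrightarrow> finite {k. coord x k \<noteq> 0}"
proof
  assume "x \<in> basis_span"
  then obtain F c where F: "finite F" "x = (\<Sum>k\<in>F. c k *\<^sub>C basis_vec k)"
    by (auto simp: basis_span_def)
  have "{k. coord x k \<noteq> 0} \<subseteq> F"
    using F by (auto simp: coord_sum coord_scaleC coord_basis_vec if_distrib cong: if_cong
        intro: ccontr)
  then show "finite {k. coord x k \<noteq> 0}" using F(1) finite_subset by blast
next
  assume f: "finite {k. coord x k \<noteq> 0}"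
  have "x = (\<Sum>k\<in>{k. coord x k \<noteq> 0}. coord x k *\<^sub>C basis_vec k)"
    by (rule ell2_eqI)
      (use f in \<open>simp add: coord_sum coord_scaleC coord_basis_vec if_distrib cong: if_cong\<close>)
  then show "x \<in> basis_span" using f unfolding basis_span_def by blast
qed

lemma basis_span_zero: "0 \<in> basis_span"
  by (simp add: basis_span_iff coord_zero)

lemma basis_span_basis_vec: "basis_vec k \<in> basis_span"
  by (simp add: basis_span_iff coord_basis_vec)

lemma basis_span_scaleC: "x \<in> basis_span \<Longrightarrow> c *\<^sub>C x \<in> basis_span"
  unfolding basis_span_iff by (erule rev_finite_subset) (auto simp: coord_scaleC)

lemma basis_span_add: "x \<in> basis_span \<Longrightarrow> y \<in> basis_span \<Longrightarrow> x + y \<in> basis_span"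
  unfolding basis_span_iff
  by (rule finite_subset[of _ "{k. coord x k \<noteq> 0} \<union> {k. coord y k \<noteq> 0}"]) (auto simp: coord_add)

lemma basis_span_sum: "(\<And>k. k \<in> F \<Longrightarrow> f k \<in> basis_span) \<Longrightarrow> (\<Sum>k\<in>F. f k) \<in> basis_span"
  by (induction F rule: infinite_finite_induct) (auto intro: basis_span_add basis_span_zero)

lemma basis_span_induct [consumes 1, case_names basis add scale]:
  assumes "x \<in> basis_span"
    and basis: "\<And>k. P (basis_vec k)"
    and add: "\<And>x y. x \<in> basis_span \<Longrightarrow> y \<in> basis_span \<Longrightarrow> P x \<Longrightarrow> P y \<Longrightarrow> P (x + y)"
    and scale: "\<And>c x. x \<in> basis_span \<Longrightarrow> P x \<Longrightarrow> P (c *\<^sub>C x)"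
  shows "P x"
proof -
  \<comment> \<open>The rule offers no case for zero, which the empty sum needs; zero is a multiple
    of a basis vector.\<close>
  have "P (0 *\<^sub>C basis_vec 0)" by (intro scale basis basis_span_basis_vec)
  moreover have "0 *\<^sub>C basis_vec 0 = 0" by (rule ell2_eqI) (simp add: coord_scaleC coord_zero)
  ultimately have zero: "P 0" by simp
  obtain F c where "x = (\<Sum>k\<in>F. c k *\<^sub>C basis_vec k)"
    using assms(1) by (auto simp: basis_span_def)
  moreover have "P (\<Sum>k\<in>F. c k *\<^sub>C basis_vec k)"
    by (induction F rule: infinite_finite_induct)
      (auto intro!: zero add scale basis basis_span_sum basis_span_scaleC basis_span_basis_vec)
  ultimately show ?thesis by simp
qed

text \<open>Truncations converge to the vector, so the finitely supported vectors are dense. This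
  turns identities between commutators on \<open>basis_span\<close> into identities between bounded
  operators.\<close>

lemma blinfun_eq_on_basis_span:
  fixes S T :: operator
  assumes "\<And>x. x \<in> basis_span \<Longrightarrow> blinfun_apply S x = blinfun_apply T x"
  shows "S = T"
proof (rule blinfun_eqI)
  fix x
  have "trunc n c \<in> basis_span" for n c
    unfolding trunc_def by (intro basis_span_sum basis_span_scaleC basis_span_basis_vec)
  then have "(\<lambda>n. blinfun_apply S (trunc n (coord x))) = (\<lambda>n. blinfun_apply T (trunc n (coord x)))"
    using assms by auto
  moreover have "(\<lambda>n. blinfun_apply R (trunc n (coord x))) \<longlonglongrightarrow> blinfun_apply R x" for R :: operator
    by (intro blinfun.tendsto tendsto_const tendsto_trunc)
  ultimately show "blinfun_apply S x = blinfun_apply T x"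
    using LIMSEQ_unique by metis
qed

section \<open>Bounded operators and adjoints\<close>

lemma bounded_operatorsD:
  "T \<in> bounded_operators \<Longrightarrow> blinfun_apply T (c *\<^sub>C x) = c *\<^sub>C blinfun_apply T x"
  by (simp add: bounded_operators_def)

lemma scaleC_add_right: "c *\<^sub>C (x + y) = c *\<^sub>C x + c *\<^sub>C y"
  by (rule ell2_eqI) (simp add: coord_scaleC coord_add algebra_simps)

lemma scaleC_scaleC: "c *\<^sub>C e *\<^sub>C x = (c * e) *\<^sub>C x"
  by (rule ell2_eqI) (simp add: coord_scaleC)

lemma scaleC_zero_right: "c *\<^sub>C 0 = 0"
  by (rule ell2_eqI) (simp add: coord_scaleC coord_zero)

lemma scaleC_diff_right: "c *\<^sub>C (x - y) = c *\<^sub>C x - c *\<^sub>C y"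
  by (rule ell2_eqI) (simp add: coord_scaleC coord_minus algebra_simps)

lemma is_adjoint_sym: "is_adjoint S T \<Longrightarrow> is_adjoint T S"
  unfolding is_adjoint_def by (metis cinner_commute)

lemma adj_adj: "T \<in> bounded_operators \<Longrightarrow> adj (adj T) = T"
  by (rule adj_eqI[OF is_adjoint_sym[OF is_adjoint_adj]])

lemma coord_adj:
  assumes "T \<in> bounded_operators"
  shows "coord (blinfun_apply (adj T) x) k = cinner x (blinfun_apply T (basis_vec k))"
  using is_adjoint_adj[OF assms] unfolding is_adjoint_def by (metis cinner_basis_vec)

lemma bounded_operators_closed:
  "0 \<in> bounded_operators" "id_blinfun \<in> bounded_operators"
  "S \<in> bounded_operators \<Longrightarrow> T \<in> bounded_operators \<Longrightarrow> S + T \<in> bounded_operators"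
  "T \<in> bounded_operators \<Longrightarrow> scaleC_op c T \<in> bounded_operators"
  "S \<in> bounded_operators \<Longrightarrow> T \<in> bounded_operators \<Longrightarrow> S o\<^sub>L T \<in> bounded_operators"
  by (simp_all add: bounded_operators_def blinfun.add_left blinfun_apply_scaleC_op scaleC_add_right
      scaleC_scaleC scaleC_zero_right mult.commute)

lemma adj_bounded_operators:
  assumes "T \<in> bounded_operators"
  shows "adj T \<in> bounded_operators"
  unfolding bounded_operators_def
  by (auto intro!: ell2_eqI simp: coord_adj[OF assms] coord_scaleC cinner_scaleC_left)

lemma adj_add:
  assumes "S \<in> bounded_operators" "T \<in> bounded_operators"
  shows "adj (S + T) = adj S + adj T"
  using assms is_adjoint_adj[OF assms(1)] is_adjoint_adj[OF assms(2)]
  by (intro adj_eqI)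
    (auto simp: is_adjoint_def blinfun.add_left cinner_add_left cinner_add_right)

lemma adj_scaleC_op:
  assumes "T \<in> bounded_operators"
  shows "adj (scaleC_op c T) = scaleC_op (cnj c) (adj T)"
  using is_adjoint_adj[OF assms]
  by (intro adj_eqI)
    (auto simp: is_adjoint_def blinfun_apply_scaleC_op cinner_scaleC_left cinner_scaleC_right)

lemma adj_comp:
  assumes "S \<in> bounded_operators" "T \<in> bounded_operators"
  shows "adj (S o\<^sub>L T) = adj T o\<^sub>L adj S"
  using is_adjoint_adj[OF assms(1)] is_adjoint_adj[OF assms(2)]
  by (intro adj_eqI) (auto simp: is_adjoint_def)

section \<open>Coordinate formulas for diagonal operators and powers of the shift\<close>

lemma shift_bounded_operators: "shift \<in> bounded_operators"
  unfolding bounded_operators_def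
  by (auto intro!: ell2_eqI simp: coord_shift coord_scaleC split: nat.split)

lemma coord_bdiag:
  assumes "\<And>k. cmod (a k) \<le> B"
  shows "coord (blinfun_apply (bdiag a) x) k = a k * coord x k"
  by (simp add: blinfun_apply_bdiag[OF assms] coord_diag_op_bounded[OF assms])

lemma bdiag_bounded_operators:
  assumes "\<And>k. cmod (a k) \<le> B"
  shows "bdiag a \<in> bounded_operators"
  unfolding bounded_operators_def
  by (auto intro!: ell2_eqI simp: coord_bdiag[OF assms] coord_scaleC)

lemma adj_bdiag:
  assumes "\<And>k. cmod (a k) \<le> B"
  shows "adj (bdiag a) = bdiag (\<lambda>k. cnj (a k))"
proof (intro blinfun_eqI ell2_eqI)
  fix x k
  have cnj: "cmod (cnj (a k)) \<le> B" for k using assms by simp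
  then show "coord (blinfun_apply (adj (bdiag a)) x) k
      = coord (blinfun_apply (bdiag (\<lambda>k. cnj (a k))) x) k"
    by (simp add: coord_adj[OF bdiag_bounded_operators[OF assms]] coord_bdiag[OF cnj]
        blinfun_apply_bdiag[OF assms] diag_op_basis_vec cinner_scaleC_right cinner_basis_vec)
qed

lemma coord_adj_shift: "coord (blinfun_apply (adj shift) x) k = coord x (Suc k)"
  by (simp add: coord_adj[OF shift_bounded_operators] shift_basis_vec cinner_basis_vec)

lemma coord_shift_power:
  "coord ((blinfun_apply shift ^^ n) x) k = (if k < n then 0 else coord x (k - n))"
  by (induction n arbitrary: k) (auto simp: coord_shift split: nat.split)

lemma coord_adj_shift_power: "coord ((blinfun_apply (adj shift) ^^ n) x) k = coord x (k + n)"
  by (induction n arbitrary: k) (auto simp: coord_adj_shift)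

lemma basis_span_shift: "x \<in> basis_span \<Longrightarrow> blinfun_apply shift x \<in> basis_span"
proof (induction x rule: basis_span_induct)
qed (simp_all add: shift_basis_vec basis_span_basis_vec blinfun.add_right basis_span_add
    bounded_operatorsD[OF shift_bounded_operators] basis_span_scaleC)

lemma basis_span_adj_shift:
  assumes "x \<in> basis_span"
  shows "blinfun_apply (adj shift) x \<in> basis_span"
proof -
  have "finite (Suc -` {k. coord x k \<noteq> 0})"
    using assms by (intro finite_vimageI) (simp_all add: basis_span_iff)
  then show ?thesis by (simp add: basis_span_iff coord_adj_shift vimage_def)
qed

lemma basis_span_bdiag:
  assumes "\<And>k. cmod (a k) \<le> B" "x \<in> basis_span"
  shows "blinfun_apply (bdiag a) x \<in> basis_span"
  using assms(2) unfolding basis_span_iff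
  by (rule rev_finite_subset) (auto simp: coord_bdiag[OF assms(1)])

text \<open>\<open>twisted_diag\<close> iterates functions on vectors; membership in an algebra
  requires the iterate as an operator.\<close>

definition op_power :: "operator \<Rightarrow> nat \<Rightarrow> operator" where
  "op_power T n = (((o\<^sub>L) T) ^^ n) id_blinfun"

lemma blinfun_apply_op_power: "blinfun_apply (op_power T n) x = (blinfun_apply T ^^ n) x"
  unfolding op_power_def by (induction n) auto

section \<open>The algebras\<close>

text \<open>Shows that the hulls are star subalgebras themselves. An empty family would intersect to
  all real linear operators, hence the nonemptiness.\<close>

lemma star_subalgebra_Inter:
  "C \<noteq> {} \<Longrightarrow> (\<And>B. B \<in> C \<Longrightarrow> star_subalgebra B) \<Longrightarrow> star_subalgebra (\<Inter>C)"
  unfolding star_subalgebra_def by (intro conjI) (blast+)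

lemma star_subalgebra_bounded_operators: "star_subalgebra bounded_operators"
  unfolding star_subalgebra_def by (auto intro: bounded_operators_closed adj_bounded_operators)

text \<open>Makes \<open>bounded_operators\<close> a member of the family whose intersection is
  \<open>A_cstar\<close>.\<close>

lemma closed_bounded_operators: "closed bounded_operators"
proof -
  \<comment> \<open>Complex scaling becomes a bounded operator, so the continuity rules apply to
    both sides of the defining equation.\<close>
  have scaleC: "c *\<^sub>C y = blinfun_apply (bdiag (\<lambda>_. c)) y" for c y
    by (rule ell2_eqI) (simp add: coord_bdiag[of _ "cmod c"] coord_scaleC)
  show ?thesis
    unfolding bounded_operators_def scaleC
    by (intro closed_Collect_all closed_Collect_eq continuous_intros)
qed

lemma generators_bounded: "insert shift (A_diag_per N) \<subseteq> bounded_operators"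
proof -
  have "bdiag a \<in> bounded_operators" if "j > 0" "\<forall>k. a (k + j) = a k" for a j
    using bounded_periodic[OF that] bdiag_bounded_operators by blast
  then show ?thesis by (auto simp: A_diag_per_def shift_bounded_operators)
qed

lemma star_subalgebra_A_alg: "star_subalgebra (A_alg N)"
  unfolding A_alg_def hull_def
  by (rule star_subalgebra_Inter)
    (use generators_bounded star_subalgebra_bounded_operators in auto)

lemma star_subalgebra_A_cstar: "star_subalgebra (A_cstar N)"
  unfolding A_cstar_def hull_def
  by (rule star_subalgebra_Inter)
    (use generators_bounded star_subalgebra_bounded_operators closed_bounded_operators in auto)

lemma generators_A_alg: "insert shift (A_diag_per N) \<subseteq> A_alg N"
  unfolding A_alg_def by (rule hull_subset)

lemma A_alg_subset_A_cstar: "A_alg N \<subseteq> A_cstar N"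
  unfolding A_alg_def
  by (rule hull_minimal[where S = star_subalgebra, OF _ star_subalgebra_A_cstar])
    (unfold A_cstar_def, rule hull_subset)

lemma star_subalgebra_closed:
  assumes "star_subalgebra A"
  shows "0 \<in> A" "S \<in> A \<Longrightarrow> T \<in> A \<Longrightarrow> S + T \<in> A" "T \<in> A \<Longrightarrow> scaleC_op c T \<in> A"
    "S \<in> A \<Longrightarrow> T \<in> A \<Longrightarrow> S o\<^sub>L T \<in> A" "T \<in> A \<Longrightarrow> adj T \<in> A" "T \<in> A \<Longrightarrow> T \<in> bounded_operators"
  using assms unfolding star_subalgebra_def by blast+

lemmas A_alg_closed = star_subalgebra_closed[OF star_subalgebra_A_alg]
lemmas A_cstar_closed = star_subalgebra_closed[OF star_subalgebra_A_cstar]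

lemma scaleC_op_minus_one: "scaleC_op (- 1) T = - T"
  by (intro blinfun_eqI ell2_eqI)
    (simp add: blinfun_apply_scaleC_op coord_scaleC blinfun.minus_left coord_uminus)

lemma star_subalgebra_uminus: "star_subalgebra A \<Longrightarrow> T \<in> A \<Longrightarrow> - T \<in> A"
  by (metis scaleC_op_minus_one star_subalgebra_closed(3))

lemma star_subalgebra_diff: "star_subalgebra A \<Longrightarrow> S \<in> A \<Longrightarrow> T \<in> A \<Longrightarrow> S - T \<in> A"
  by (metis diff_conv_add_uminus star_subalgebra_closed(2) star_subalgebra_uminus)

section \<open>Elements of the polynomial algebra and induction over it\<close>

lemma adj_shift_shift: "adj shift o\<^sub>L shift = id_blinfun"
  by (intro blinfun_eqI ell2_eqI) (simp add: coord_adj_shift coord_shift)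

lemma shift_A_alg: "shift \<in> A_alg N"
  using generators_A_alg by auto

lemma id_A_alg: "id_blinfun \<in> A_alg N"
  by (metis A_alg_closed(4,5) adj_shift_shift shift_A_alg)

lemma op_power_A_alg: "T \<in> A_alg N \<Longrightarrow> op_power T n \<in> A_alg N"
  unfolding op_power_def by (induction n) (auto intro: id_A_alg A_alg_closed)

lemma bdiag_periodic_A_alg:
  assumes "j > 0" "dvd_supernatural j N" "\<forall>k. a (k + j) = a k"
  shows "bdiag a \<in> A_alg N"
  using assms generators_A_alg[of N] by (auto simp: A_diag_per_def)

text \<open>A case for adjoints is avoided by carrying \<open>P a\<close> and
  \<open>P (adj a)\<close> together. The set of such \<open>a\<close> is closed under adjoints by
  construction, and the adjoints of the generators are \<open>adj shift\<close> and the diagonal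
  operators of conjugate periodic sequences.\<close>

lemma A_alg_induct [consumes 1, case_names shift adj_shift periodic add scale comp]:
  assumes "a \<in> A_alg N"
    and shift: "P shift" and adj_shift: "P (adj shift)"
    and periodic: "\<And>b j. j > 0 \<Longrightarrow> dvd_supernatural j N \<Longrightarrow> \<forall>k. b (k + j) = b k \<Longrightarrow> P (bdiag b)"
    and add: "\<And>a b. a \<in> A_alg N \<Longrightarrow> b \<in> A_alg N \<Longrightarrow> P a \<Longrightarrow> P b \<Longrightarrow> P (a + b)"
    and scale: "\<And>c a. a \<in> A_alg N \<Longrightarrow> P a \<Longrightarrow> P (scaleC_op c a)"
    and comp: "\<And>a b. a \<in> A_alg N \<Longrightarrow> b \<in> A_alg N \<Longrightarrow> P a \<Longrightarrow> P b \<Longrightarrow> P (a o\<^sub>L b)"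
  shows "P a"
proof -
  let ?G = "{a \<in> A_alg N. P a \<and> P (adj a)}"
  have zero: "P 0"
  proof -
    have "scaleC_op 0 shift = 0"
      by (intro blinfun_eqI ell2_eqI) (simp add: blinfun_apply_scaleC_op coord_scaleC coord_zero)
    then show ?thesis by (metis scale shift shift_A_alg)
  qed
  have adj_zero: "adj 0 = 0"
    by (rule adj_eqI) (simp add: is_adjoint_def, metis cinner_basis_vec cinner_sum_right sum.empty
        cinner_commute complex_cnj_zero)
  have "star_subalgebra ?G"
    unfolding star_subalgebra_def
    by (auto simp: adj_add adj_scaleC_op adj_comp adj_adj adj_zero A_alg_closed
        intro!: zero add scale comp)
  moreover have "insert shift (A_diag_per N) \<subseteq> ?G"
  proof -
    have "bdiag b \<in> ?G" if b: "j > 0" "dvd_supernatural j N" "\<forall>k. b (k + j) = b k" for b j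
    proof -
      obtain B where B: "\<And>k. cmod (b k) \<le> B" using bounded_periodic[OF b(1,3)] by blast
      have "P (bdiag (\<lambda>k. cnj (b k)))" using b by (intro periodic) auto
      then show ?thesis using b periodic bdiag_periodic_A_alg by (simp add: adj_bdiag[OF B])
    qed
    then show ?thesis by (auto simp: A_diag_per_def shift adj_shift shift_A_alg)
  qed
  ultimately have "A_alg N \<subseteq> ?G"
    unfolding A_alg_def[of N] by (intro hull_minimal) (simp_all add: A_alg_def)
  then show ?thesis using assms(1) by blast
qed

text \<open>Checked on the generators. It allows an unbounded \<open>twisted_diag\<close> to be
  applied after \<open>a\<close>.\<close>

lemma A_alg_basis_span:
  assumes "a \<in> A_alg N" "x \<in> basis_span"
  shows "blinfun_apply a x \<in> basis_span"
  using assms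
proof (induction a arbitrary: x rule: A_alg_induct)
  case (periodic b j)
  then show ?case using bounded_periodic basis_span_bdiag by metis
qed (simp_all add: basis_span_shift basis_span_adj_shift blinfun.add_left basis_span_add
    blinfun_apply_scaleC_op basis_span_scaleC)

section \<open>Diagonal operators in the C*-algebra\<close>

lemma diag_mem_iff:
  "diag_mem N \<beta> \<longleftrightarrow> (\<exists>T\<in>A_cstar N. \<forall>x k. coord (blinfun_apply T x) k = \<beta> k * coord x k)"
proof
  assume "diag_mem N \<beta>"
  then obtain T where T: "T \<in> A_cstar N" "\<And>k. blinfun_apply T (basis_vec k) = \<beta> k *\<^sub>C basis_vec k"
    unfolding diag_mem_def A_diag_def by blast
  have b: "T \<in> bounded_operators" using T(1) by (rule A_cstar_closed(6))
  have "coord (blinfun_apply T x) k = \<beta> k * coord x k" for x k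
  proof -
    \<comment> \<open>Only the columns of \<open>T\<close> are known. Coordinate k of T x is the
      inner product of x with T^* E_k, which replaces a limit over expansions of x.\<close>
    have "coord (blinfun_apply (adj T) (basis_vec k)) i = cnj (\<beta> k) * coord (basis_vec k) i" for i
      by (simp add: coord_adj[OF b] T(2) cinner_scaleC_right cinner_basis_vec coord_basis_vec)
    then have "blinfun_apply (adj T) (basis_vec k) = cnj (\<beta> k) *\<^sub>C basis_vec k"
      by (intro ell2_eqI) (simp add: coord_scaleC)
    moreover have "coord (blinfun_apply T x) k = cinner x (blinfun_apply (adj T) (basis_vec k))"
      using coord_adj[OF adj_bounded_operators[OF b]] by (simp add: adj_adj[OF b])
    ultimately show ?thesis by (simp add: cinner_scaleC_right cinner_basis_vec)
  qed
  then show "\<exists>T\<in>A_cstar N. \<forall>x k. coord (blinfun_apply T x) k = \<beta> k * coord x k"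
    using T(1) by blast
next
  assume "\<exists>T\<in>A_cstar N. \<forall>x k. coord (blinfun_apply T x) k = \<beta> k * coord x k"
  then obtain T where T: "T \<in> A_cstar N" "\<And>x k. coord (blinfun_apply T x) k = \<beta> k * coord x k"
    by blast
  then have "blinfun_apply T (basis_vec k) = \<beta> k *\<^sub>C basis_vec k" for k
    by (intro ell2_eqI) (simp add: coord_scaleC coord_basis_vec)
  then show "diag_mem N \<beta>" using T(1) unfolding diag_mem_def A_diag_def by blast
qed

lemma diag_memI:
  assumes "T \<in> A_cstar N" "\<And>k i. coord (blinfun_apply T (basis_vec k)) i = (if i = k then \<beta> k else 0)"
  shows "diag_mem N \<beta>"
proof -
  have "blinfun_apply T (basis_vec k) = \<beta> k *\<^sub>C basis_vec k" for k
    by (intro ell2_eqI) (simp add: coord_scaleC coord_basis_vec assms(2))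
  then show ?thesis using assms(1) unfolding diag_mem_def A_diag_def by blast
qed

section \<open>Divisors of supernatural numbers\<close>

lemma multiplicity_supernatural_value:
  assumes "finite_supernatural N" "prime p"
  shows "enat (multiplicity p (supernatural_value N)) = N p"
proof -
  have "multiplicity p (supernatural_value N) = (if N p \<noteq> 0 then the_enat (N p) else 0)"
    unfolding supernatural_value_def
    by (subst multiplicity_prod_prime_powers) (use assms in \<open>auto simp: finite_supernatural_def\<close>)
  then show ?thesis using assms by (auto simp: finite_supernatural_def zero_enat_def)
qed

lemma supernatural_value_pos: "supernatural_value N > 0"
  unfolding supernatural_value_def by (rule prod_pos) (auto simp: prime_gt_0_nat)

lemma dvd_supernatural_prime_power:
  assumes "prime p" "enat e \<le> N p"
  shows "dvd_supernatural (p ^ e) N"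
  unfolding dvd_supernatural_def
proof (intro allI impI)
  fix q :: nat assume "prime q"
  then show "enat (multiplicity q (p ^ e)) \<le> N q"
    using assms by (cases "q = p")
      (auto simp: multiplicity_distinct_prime_power zero_enat_def[symmetric])
qed

text \<open>Either some exponent is infinite, and powers of that prime grow beyond m, or infinitely
  many primes divide N, and one of them exceeds m.\<close>

lemma infinite_supernatural_large_divisor:
  assumes "\<not> finite_supernatural N"
  shows "\<exists>j>m. dvd_supernatural j N"
proof (cases "\<exists>p. prime p \<and> N p = \<infinity>")
  case True
  then obtain p where p: "prime p" "N p = \<infinity>" by blast
  then have "m < p ^ m" using prime_gt_1_nat[of p] by (intro power_gt_expt) simp
  moreover have "dvd_supernatural (p ^ m) N" using p by (intro dvd_supernatural_prime_power) auto
  ultimately show ?thesis by blast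
next
  case False
  then have "infinite {p. prime p \<and> N p \<noteq> 0}"
    using assms by (auto simp: finite_supernatural_def)
  then obtain p where p: "p > m" "prime p" "N p \<noteq> 0"
    unfolding infinite_nat_iff_unbounded by blast
  then have "enat 1 \<le> N p"
    by (metis one_enat_def ileI1 i0_lb le_neq_trans one_eSuc)
  then have "dvd_supernatural (p ^ 1) N" using p by (intro dvd_supernatural_prime_power)
  then show ?thesis using p by auto
qed

text \<open>Gives the case distinction in \<open>beta_condition\<close> one uniform form. A finite N
  has its value as largest divisor; an infinite N has divisors beyond |n|, which cannot divide a
  nonzero n.\<close>

lemma exists_divisor_not_dvd_iff:
  "(\<exists>j>0. dvd_supernatural j N \<and> \<not> int j dvd n) \<longleftrightarrow>
    (\<not> finite_supernatural N \<and> n \<noteq> 0) \<or>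
      (finite_supernatural N \<and> \<not> int (supernatural_value N) dvd n)"
proof (cases "finite_supernatural N")
  case True
  have "j dvd supernatural_value N" if "j > 0" "dvd_supernatural j N" for j
  proof (rule multiplicity_le_imp_dvd)
    show "multiplicity p j \<le> multiplicity p (supernatural_value N)" if "prime p" for p
      using \<open>dvd_supernatural j N\<close> that multiplicity_supernatural_value[OF True that]
      unfolding dvd_supernatural_def by (metis enat_ord_simps(1))
  qed (use that supernatural_value_pos[of N] in auto)
  moreover have "dvd_supernatural (supernatural_value N) N"
    by (simp add: dvd_supernatural_def multiplicity_supernatural_value[OF True])
  ultimately show ?thesis
    using True supernatural_value_pos[of N] by (meson dvd_trans int_dvd_int_iff)
next
  case False
  have "\<exists>j>0. dvd_supernatural j N \<and> \<not> int j dvd n" if "n \<noteq> 0"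
  proof -
    obtain j where "j > nat \<bar>n\<bar>" "dvd_supernatural j N"
      using infinite_supernatural_large_divisor[OF False] by blast
    moreover then have "\<not> int j dvd n"
      using that zdvd_imp_le[of "int j" "\<bar>n\<bar>"] by auto
    ultimately show ?thesis by (metis gr_zeroI not_less_zero)
  qed
  then show ?thesis using False by auto
qed

section \<open>The operators \<open>U\<^sup>n \<beta>(\<bbbK>)\<close> and \<open>\<beta>(\<bbbK>) (U\<^sup>*)\<^sup>-\<^sup>n\<close>\<close>

text \<open>On finite support the series has finitely many terms, so the dummy value of
  \<open>diag_op\<close> never occurs.\<close>

lemma coord_diag_op_basis_span:
  assumes "x \<in> basis_span"
  shows "coord (diag_op \<beta> x) k = \<beta> k * coord x k"
proof -
  have "summable (\<lambda>k. (cmod (\<beta> k * coord x k))\<^sup>2)"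
    using assms by (intro summable_finite[of "{k. coord x k \<noteq> 0}"]) (auto simp: basis_span_iff)
  then show ?thesis by (simp add: diag_op_def coord_Abs_ell2)
qed

lemma basis_span_adj_shift_power:
  "x \<in> basis_span \<Longrightarrow> (blinfun_apply (adj shift) ^^ m) x \<in> basis_span"
  by (induction m) (auto intro: basis_span_adj_shift)

lemma coord_twisted_diag:
  assumes "x \<in> basis_span"
  shows "coord (twisted_diag n \<beta> x) k =
    (if n \<ge> 0 then if k < nat n then 0 else \<beta> (k - nat n) * coord x (k - nat n)
     else \<beta> k * coord x (k + nat (- n)))"
  using assms
  by (simp add: twisted_diag_def coord_shift_power coord_diag_op_basis_span coord_adj_shift_power
      basis_span_adj_shift_power)

lemma twisted_diag_add:
  "x \<in> basis_span \<Longrightarrow> y \<in> basis_span \<Longrightarrow>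
    twisted_diag n \<beta> (x + y) = twisted_diag n \<beta> x + twisted_diag n \<beta> y"
  by (rule ell2_eqI) (simp add: coord_twisted_diag basis_span_add coord_add algebra_simps)

lemma twisted_diag_scaleC:
  "x \<in> basis_span \<Longrightarrow> twisted_diag n \<beta> (c *\<^sub>C x) = c *\<^sub>C twisted_diag n \<beta> x"
  by (rule ell2_eqI) (simp add: coord_twisted_diag basis_span_scaleC coord_scaleC)

lemma twisted_diag_zero: "twisted_diag n \<beta> 0 = 0"
  by (rule ell2_eqI) (simp add: coord_twisted_diag basis_span_zero coord_zero)

lemma twisted_diag_sum:
  "(\<And>k. k \<in> F \<Longrightarrow> f k \<in> basis_span) \<Longrightarrow>
    twisted_diag n \<beta> (\<Sum>k\<in>F. f k) = (\<Sum>k\<in>F. twisted_diag n \<beta> (f k))"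
  by (induction F rule: infinite_finite_induct)
    (auto simp: twisted_diag_zero twisted_diag_add basis_span_sum)

definition commutator :: "int \<Rightarrow> (nat \<Rightarrow> complex) \<Rightarrow> operator \<Rightarrow> ell2 \<Rightarrow> ell2" where
  "commutator n \<beta> a x = twisted_diag n \<beta> (blinfun_apply a x) - blinfun_apply a (twisted_diag n \<beta> x)"

lemma implements_iff:
  "implements N n \<beta> d \<longleftrightarrow>
    (\<forall>a\<in>A_alg N. \<forall>x\<in>basis_span. blinfun_apply (d a) x = commutator n \<beta> a x)"
  by (simp add: implements_def commutator_def)

lemma commutator_eq_iff_basis:
  assumes T: "T \<in> bounded_operators" and a: "a \<in> A_alg N"
  shows "(\<forall>x\<in>basis_span. blinfun_apply T x = commutator n \<beta> a x) \<longleftrightarrow>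
    (\<forall>k. blinfun_apply T (basis_vec k) = commutator n \<beta> a (basis_vec k))"
proof
  assume *: "\<forall>k. blinfun_apply T (basis_vec k) = commutator n \<beta> a (basis_vec k)"
  have b: "a \<in> bounded_operators" using a by (rule A_alg_closed(6))
  have "blinfun_apply T x = commutator n \<beta> a x" if "x \<in> basis_span" for x
    using that
  proof (induction x rule: basis_span_induct)
    case (add x y)
    then show ?case
      by (simp add: commutator_def blinfun.add_right twisted_diag_add A_alg_basis_span[OF a])
  next
    case (scale c x)
    then show ?case
      by (simp add: commutator_def bounded_operatorsD[OF b] bounded_operatorsD[OF T]
          twisted_diag_scaleC A_alg_basis_span[OF a] scaleC_diff_right)
  qed (use * in simp)
  then show "\<forall>x\<in>basis_span. blinfun_apply T x = commutator n \<beta> a x" by blast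
qed (simp add: basis_span_basis_vec)

section \<open>Derivations implemented by commutators\<close>

lemma commutator_add:
  "a \<in> A_alg N \<Longrightarrow> b \<in> A_alg N \<Longrightarrow> x \<in> basis_span \<Longrightarrow>
    commutator n \<beta> (a + b) x = commutator n \<beta> a x + commutator n \<beta> b x"
  by (simp add: commutator_def blinfun.add_left twisted_diag_add A_alg_basis_span)

lemma commutator_scaleC:
  "a \<in> A_alg N \<Longrightarrow> x \<in> basis_span \<Longrightarrow>
    commutator n \<beta> (scaleC_op c a) x = c *\<^sub>C commutator n \<beta> a x"
  by (simp add: commutator_def blinfun_apply_scaleC_op twisted_diag_scaleC A_alg_basis_span
      scaleC_diff_right)

text \<open>The Leibniz rule: writing B for the twisted diagonal operator, the terms a B b
  cancel.\<close>

lemma commutator_comp: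
  "commutator n \<beta> (a o\<^sub>L b) x =
    commutator n \<beta> a (blinfun_apply b x) + blinfun_apply a (commutator n \<beta> b x)"
  by (simp add: commutator_def blinfun.diff_right)

text \<open>The middle ground of both directions: it follows from \<open>beta_condition\<close>, and
  it also follows from a derivation implemented by \<open>\<beta>\<close>, where
  \<open>beta_condition\<close> is then recovered from it.\<close>

definition inner_on :: "supernatural \<Rightarrow> int \<Rightarrow> (nat \<Rightarrow> complex) \<Rightarrow> operator \<Rightarrow> bool" where
  "inner_on N n \<beta> a \<longleftrightarrow>
    (\<exists>T\<in>A_cstar N. \<forall>x\<in>basis_span. blinfun_apply T x = commutator n \<beta> a x)"

text \<open>Here the twisted diagonal operator B lies in the C*-algebra, hence so does B a - a
  B.\<close>

lemma inner_on_bounded: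
  assumes "diag_mem N \<beta>" "a \<in> A_alg N"
  shows "inner_on N n \<beta> a"
proof -
  obtain D where D: "D \<in> A_cstar N" "\<And>x k. coord (blinfun_apply D x) k = \<beta> k * coord x k"
    using assms(1) by (auto simp: diag_mem_iff)
  define B where "B = (if n \<ge> 0 then op_power shift (nat n) o\<^sub>L D
    else D o\<^sub>L op_power (adj shift) (nat (- n)))"
  have BA: "B \<in> A_cstar N"
    using D(1) op_power_A_alg[of _ N] shift_A_alg A_alg_closed(5) A_alg_subset_A_cstar[of N]
    unfolding B_def by (auto intro!: A_cstar_closed(4))
  have B: "blinfun_apply B x = twisted_diag n \<beta> x" if "x \<in> basis_span" for x
    by (rule ell2_eqI) (simp add: B_def blinfun_apply_op_power coord_shift_power D(2)
        coord_adj_shift_power coord_twisted_diag[OF that])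
  have "(B o\<^sub>L a) - (a o\<^sub>L B) \<in> A_cstar N"
    using BA assms(2) A_alg_subset_A_cstar[of N]
    by (auto intro!: star_subalgebra_diff[OF star_subalgebra_A_cstar] A_cstar_closed(4))
  moreover have "blinfun_apply ((B o\<^sub>L a) - (a o\<^sub>L B)) x = commutator n \<beta> a x"
    if "x \<in> basis_span" for x
    using that assms(2) by (simp add: commutator_def blinfun.diff_left B A_alg_basis_span)
  ultimately show ?thesis unfolding inner_on_def by blast
qed

text \<open>B may be unbounded, but its commutators with U and U^* are products of shifts and the
  given D, and those with periodic diagonal operators vanish. The Leibniz rule extends this to all
  of \<open>A_alg\<close>.\<close>

lemma inner_on_backward_diff:
  assumes D: "diag_mem N (backward_diff \<beta>)"
    and dvd: "\<And>j. j > 0 \<Longrightarrow> dvd_supernatural j N \<Longrightarrow> int j dvd n"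
    and a: "a \<in> A_alg N"
  shows "inner_on N n \<beta> a"
proof -
  obtain D where D: "D \<in> A_cstar N"
    "\<And>x k. coord (blinfun_apply D x) k = backward_diff \<beta> k * coord x k"
    using D by (auto simp: diag_mem_iff)
  have gen: "shift \<in> A_cstar N" "adj shift \<in> A_cstar N" "op_power shift k \<in> A_cstar N"
    "op_power (adj shift) k \<in> A_cstar N" for k
    using op_power_A_alg[of _ N] shift_A_alg A_alg_closed(5) A_alg_subset_A_cstar[of N] by blast+
  show ?thesis
    using a
  proof (induction a rule: A_alg_induct)
    case shift
    \<comment> \<open>For n >= 0 the commutator is U^n D U; the inserted U U^* fixes the range of D
      U, which has no component along E_0. For n < 0 the convention beta(-1) = 0 accounts for
      coordinate 0.\<close>
    define T where "T = (if n \<ge> 0 then op_power shift (nat n + 1) o\<^sub>L adj shift o\<^sub>L D o\<^sub>L shift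
      else D o\<^sub>L op_power (adj shift) (nat (- n) - 1))"
    have "T \<in> A_cstar N" unfolding T_def by (auto intro!: A_cstar_closed(4) D gen)
    moreover have "blinfun_apply T x = commutator n \<beta> shift x" if "x \<in> basis_span" for x
      by (rule ell2_eqI)
        (auto simp: T_def commutator_def blinfun_apply_op_power coord_minus coord_shift_power
          coord_adj_shift_power coord_adj_shift coord_shift D(2) coord_twisted_diag that
          basis_span_shift backward_diff_def algebra_simps Suc_diff_le split: nat.split
          simp del: funpow.simps)
    ultimately show ?case unfolding inner_on_def by blast
  next
    case adj_shift
    \<comment> \<open>For n < 0 the factor \<open>adj shift o\<^sub>L D o\<^sub>L shift\<close> is
      diagonal with entries beta(k+1) - beta(k).\<close>
    define T where "T = - (if n \<ge> 0 then adj shift o\<^sub>L op_power shift (nat n) o\<^sub>L D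
      else adj shift o\<^sub>L D o\<^sub>L shift o\<^sub>L op_power (adj shift) (nat (- n) + 1))"
    have "T \<in> A_cstar N" unfolding T_def
      by (auto intro!: A_cstar_closed(4) D gen star_subalgebra_uminus[OF star_subalgebra_A_cstar])
    moreover have "blinfun_apply T x = commutator n \<beta> (adj shift) x" if "x \<in> basis_span" for x
      by (rule ell2_eqI)
        (auto simp: T_def commutator_def blinfun_apply_op_power coord_minus coord_shift_power
          coord_adj_shift_power coord_adj_shift coord_shift D(2) coord_twisted_diag that
          basis_span_adj_shift backward_diff_def algebra_simps Suc_diff_le
          blinfun.minus_left coord_uminus split: nat.split simp del: funpow.simps)
    ultimately show ?case unfolding inner_on_def by blast
  next
    case (periodic b j)
    obtain B where B: "\<And>k. cmod (b k) \<le> B" using bounded_periodic[OF periodic(1,3)] by blast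
    have mult: "b (k + m * j) = b k" for k m
      using periodic(3) by (induction m) (auto simp: algebra_simps, metis add.assoc add.commute)
    obtain q where "n = int j * q" using dvd[OF periodic(1,2)] by blast
    then have q: "nat \<bar>n\<bar> = nat \<bar>q\<bar> * j" by (simp add: abs_mult nat_mult_distrib)
    \<comment> \<open>As j divides n, the sequence has period |n|, so its diagonal operator commutes
      with B, which moves indices by n.\<close>
    have per: "b (k + nat \<bar>n\<bar>) = b k" for k unfolding q by (rule mult)
    have "commutator n \<beta> (bdiag b) x = 0" if "x \<in> basis_span" for x
    proof (rule ell2_eqI)
      fix k
      have "b (k - nat n) = b k" if "\<not> k < nat n" "n \<ge> 0"
        using per[of "k - nat n"] that by simp
      moreover have "b (k + nat (- n)) = b k" if "n < 0" using per[of k] that by simp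
      ultimately show "coord (commutator n \<beta> (bdiag b) x) k = coord 0 k"
        by (simp add: commutator_def coord_minus coord_bdiag[OF B] coord_zero
            coord_twisted_diag that basis_span_bdiag[OF B])
    qed
    then show ?case unfolding inner_on_def by (auto intro!: bexI[of _ 0] A_cstar_closed(1))
  next
    case (add a b)
    then obtain S T where "S \<in> A_cstar N" "T \<in> A_cstar N"
      "\<forall>x\<in>basis_span. blinfun_apply S x = commutator n \<beta> a x"
      "\<forall>x\<in>basis_span. blinfun_apply T x = commutator n \<beta> b x"
      unfolding inner_on_def by blast
    then show ?case unfolding inner_on_def using add(1,2)
      by (intro bexI[of _ "S + T"])
        (auto simp: blinfun.add_left commutator_add[of _ N] A_cstar_closed)
  next
    case (scale c a)
    then obtain T where "T \<in> A_cstar N"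
      "\<forall>x\<in>basis_span. blinfun_apply T x = commutator n \<beta> a x"
      unfolding inner_on_def by blast
    then show ?case unfolding inner_on_def using scale(1)
      by (intro bexI[of _ "scaleC_op c T"])
        (auto simp: blinfun_apply_scaleC_op commutator_scaleC[of _ N] A_cstar_closed)
  next
    case (comp a b)
    then obtain S T where "S \<in> A_cstar N" "T \<in> A_cstar N"
      "\<forall>x\<in>basis_span. blinfun_apply S x = commutator n \<beta> a x"
      "\<forall>x\<in>basis_span. blinfun_apply T x = commutator n \<beta> b x"
      unfolding inner_on_def by blast
    moreover have "a \<in> A_cstar N" "b \<in> A_cstar N" using comp A_alg_subset_A_cstar by blast+
    ultimately show ?case unfolding inner_on_def using comp(2)
      by (intro bexI[of _ "(S o\<^sub>L b) + (a o\<^sub>L T)"])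
        (auto simp: blinfun.add_left commutator_comp A_cstar_closed A_alg_basis_span)
  qed
qed

lemma beta_condition_iff:
  "beta_condition N n \<beta> \<longleftrightarrow>
    (if \<exists>j>0. dvd_supernatural j N \<and> \<not> int j dvd n then diag_mem N \<beta>
     else diag_mem N (backward_diff \<beta>))"
  unfolding beta_condition_def exists_divisor_not_dvd_iff ..

lemma inner_on_beta_condition:
  "beta_condition N n \<beta> \<Longrightarrow> a \<in> A_alg N \<Longrightarrow> inner_on N n \<beta> a"
  unfolding beta_condition_iff
  by (auto intro: inner_on_bounded inner_on_backward_diff split: if_splits)

text \<open>\<open>inner_on\<close> supplies an element of \<open>A_cstar\<close> that agrees with
  \<open>d a\<close> on a dense set; the algebraic laws are likewise checked on
  \<open>basis_span\<close>.\<close>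

lemma derivation_in_if_implements:
  assumes \<beta>: "beta_condition N n \<beta>" and d: "implements N n \<beta> d"
  shows "derivation_in N d"
proof -
  have d: "blinfun_apply (d a) x = commutator n \<beta> a x" if "a \<in> A_alg N" "x \<in> basis_span" for a x
    using d that by (simp add: implements_iff)
  have "d a \<in> A_cstar N" if a: "a \<in> A_alg N" for a
  proof -
    obtain T where T: "T \<in> A_cstar N"
      "\<forall>x\<in>basis_span. blinfun_apply T x = commutator n \<beta> a x"
      using inner_on_beta_condition[OF \<beta> a] by (auto simp: inner_on_def)
    then have "d a = T" using d[OF a] by (intro blinfun_eq_on_basis_span) simp
    then show ?thesis using T(1) by simp
  qed
  moreover have "d (a + b) = d a + d b" if "a \<in> A_alg N" "b \<in> A_alg N" for a b
    using that by (intro blinfun_eq_on_basis_span)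
      (simp add: d A_alg_closed blinfun.add_left commutator_add[of _ N])
  moreover have "d (scaleC_op c a) = scaleC_op c (d a)" if "a \<in> A_alg N" for a c
    using that by (intro blinfun_eq_on_basis_span)
      (simp add: d A_alg_closed blinfun_apply_scaleC_op commutator_scaleC[of _ N])
  moreover have "d (a o\<^sub>L b) = (d a o\<^sub>L b) + (a o\<^sub>L d b)" if "a \<in> A_alg N" "b \<in> A_alg N" for a b
    using that by (intro blinfun_eq_on_basis_span)
      (simp add: d A_alg_closed blinfun.add_left commutator_comp A_alg_basis_span)
  ultimately show ?thesis by (simp add: derivation_in_def)
qed

section \<open>Rotations and the covariance of commutators\<close>

lemma coord_rho_basis:
  assumes "a \<in> bounded_operators"
  shows "coord (blinfun_apply (rho \<theta> a) (basis_vec k)) i =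
    cis (\<theta> * (real i - real k)) * coord (blinfun_apply a (basis_vec k)) i"
proof -
  have "blinfun_apply (bdiag (\<lambda>k. cis (- (\<theta> * real k)))) (basis_vec k) =
      cis (- (\<theta> * k)) *\<^sub>C basis_vec k"
    by (simp add: blinfun_apply_bdiag[of _ 1] diag_op_basis_vec)
  then show ?thesis
    by (simp add: rho_def coord_bdiag[of _ 1] bounded_operatorsD[OF assms] coord_scaleC cis_mult
        right_diff_distrib flip: mult.assoc)
qed

lemma rho_bounded_operators: "a \<in> bounded_operators \<Longrightarrow> rho \<theta> a \<in> bounded_operators"
  unfolding rho_def by (intro bounded_operators_closed bdiag_bounded_operators[of _ 1]) auto

lemma eq_on_basis_vec:
  assumes "S \<in> bounded_operators" "T \<in> bounded_operators"
    "\<And>k i. coord (blinfun_apply S (basis_vec k)) i = coord (blinfun_apply T (basis_vec k)) i"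
  shows "S = T"
proof (rule blinfun_eq_on_basis_span)
  fix x :: ell2 assume "x \<in> basis_span"
  then show "blinfun_apply S x = blinfun_apply T x"
    by (induction x rule: basis_span_induct)
      (use assms in \<open>auto intro: ell2_eqI simp: blinfun.add_right bounded_operatorsD\<close>)
qed

text \<open>Rotation scales U and U^* by inverse phases and fixes diagonal operators; it is
  multiplicative because the inner phases cancel. Since \<open>implements\<close> constrains
  \<open>d\<close> only on \<open>A_alg\<close>, covariance needs this.\<close>

lemma rho_A_alg:
  assumes "a \<in> A_alg N"
  shows "rho \<theta> a \<in> A_alg N"
  using assms
proof (induction a rule: A_alg_induct)
  note bo = shift_bounded_operators adj_bounded_operators[OF shift_bounded_operators]
  {
    case shift
    have "rho \<theta> shift = scaleC_op (cis \<theta>) shift"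
      by (rule eq_on_basis_vec)
        (auto simp: rho_bounded_operators bounded_operators_closed bo coord_rho_basis
          blinfun_apply_scaleC_op coord_scaleC shift_basis_vec coord_basis_vec)
    then show ?case by (simp add: shift_A_alg A_alg_closed)
  next
    case adj_shift
    have "rho \<theta> (adj shift) = scaleC_op (cis (- \<theta>)) (adj shift)"
      by (rule eq_on_basis_vec)
        (auto simp: rho_bounded_operators bounded_operators_closed bo coord_rho_basis
          blinfun_apply_scaleC_op coord_scaleC coord_adj_shift coord_basis_vec)
    then show ?case by (simp add: shift_A_alg A_alg_closed)
  next
    case (periodic b j)
    obtain B where B: "\<And>k. cmod (b k) \<le> B" using bounded_periodic[OF periodic(1,3)] by blast
    have "rho \<theta> (bdiag b) = bdiag b"
      by (rule eq_on_basis_vec)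
        (auto simp: rho_bounded_operators bdiag_bounded_operators[OF B] coord_rho_basis
          coord_bdiag[OF B] coord_basis_vec)
    then show ?case using periodic bdiag_periodic_A_alg by simp
  next
    case (add a b)
    have "rho \<theta> (a + b) = rho \<theta> a + rho \<theta> b"
      by (simp add: rho_def blinfun_eqI blinfun.add_left blinfun.add_right)
    then show ?case using add A_alg_closed by simp
  next
    case (scale c a)
    have "rho \<theta> (scaleC_op c a) = scaleC_op c (rho \<theta> a)"
      by (intro blinfun_eqI ell2_eqI)
        (simp add: rho_def coord_bdiag[of _ 1] blinfun_apply_scaleC_op coord_scaleC)
    then show ?case using scale A_alg_closed by simp
  next
    case (comp a b)
    have "blinfun_apply (bdiag (\<lambda>k. cis (- (\<theta> * real k))))
        (blinfun_apply (bdiag (\<lambda>k. cis (\<theta> * real k))) x) = x" for x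
      by (rule ell2_eqI) (simp add: coord_bdiag[of _ 1] cis_mult flip: mult.assoc)
    then have "rho \<theta> (a o\<^sub>L b) = rho \<theta> a o\<^sub>L rho \<theta> b"
      by (intro blinfun_eqI) (simp add: rho_def)
    then show ?case using comp A_alg_closed by simp
  }
qed

text \<open>For n < 0 the index is lowered before \<open>\<beta>\<close> is evaluated. The natural
  subtraction is exact, as its branch has k + n >= 0.\<close>

lemma twisted_diag_basis_vec:
  "twisted_diag n \<beta> (basis_vec k) =
    (if int k + n \<ge> 0 then \<beta> (if n \<ge> 0 then k else k - nat (- n)) *\<^sub>C basis_vec (nat (int k + n))
     else 0)"
proof (cases "n \<ge> 0")
  case True
  then obtain m where "n = int m" by (metis zero_le_imp_eq_int)
  then show ?thesis
    by (intro ell2_eqI) (auto simp: coord_twisted_diag basis_span_basis_vec coord_basis_vec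
        coord_scaleC nat_int_add)
next
  case False
  then obtain m where m: "n = - int m" "m > 0" using neg_int_cases by (metis not_le)
  show ?thesis
  proof (cases "m \<le> k")
    case True
    then have "nat (int k + n) = k - m" "int k + n \<ge> 0" using m by linarith+
    then show ?thesis using m True
      by (intro ell2_eqI) (auto simp: coord_twisted_diag basis_span_basis_vec coord_basis_vec
          coord_scaleC)
  next
    case False
    then show ?thesis using m
      by (intro ell2_eqI) (auto simp: coord_twisted_diag basis_span_basis_vec coord_basis_vec
          coord_zero)
  qed
qed

lemma exp_minus_ii_eq_cis: "exp (- \<i> * of_int n * of_real \<theta>) = cis (- (of_int n * \<theta>))"
  by (simp add: cis_conv_exp algebra_simps)

text \<open>B moves indices by n, so in both B a and a B the contributing entry of \<open>a\<close>
  has row minus column equal to i - k - n.\<close>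

lemma coord_commutator_rho:
  assumes a: "a \<in> A_alg N"
  shows "coord (commutator n \<beta> (rho \<theta> a) (basis_vec k)) i =
    cis (\<theta> * (real i - real k - of_int n)) * coord (commutator n \<beta> a (basis_vec k)) i"
proof -
  have b: "a \<in> bounded_operators" and rb: "rho \<theta> a \<in> bounded_operators"
    using A_alg_closed(6)[OF a] rho_bounded_operators by blast+
  have "coord (twisted_diag n \<beta> (blinfun_apply (rho \<theta> a) (basis_vec k))) i =
    cis (\<theta> * (real i - real k - of_int n)) *
      coord (twisted_diag n \<beta> (blinfun_apply a (basis_vec k))) i"
    by (auto simp: coord_twisted_diag A_alg_basis_span[OF a] A_alg_basis_span[OF rho_A_alg[OF a]]
        basis_span_basis_vec coord_rho_basis[OF b] of_nat_diff algebra_simps)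
  moreover have "coord (blinfun_apply (rho \<theta> a) (twisted_diag n \<beta> (basis_vec k))) i =
    cis (\<theta> * (real i - real k - of_int n)) *
      coord (blinfun_apply a (twisted_diag n \<beta> (basis_vec k))) i"
    by (auto simp: twisted_diag_basis_vec bounded_operatorsD[OF b] bounded_operatorsD[OF rb]
        coord_scaleC coord_zero coord_rho_basis[OF b] algebra_simps)
  ultimately show ?thesis by (simp add: commutator_def coord_minus right_diff_distrib)
qed

lemma covariant_if_implements:
  assumes \<beta>: "beta_condition N n \<beta>" and d: "implements N n \<beta> d"
  shows "covariant N n d"
  unfolding covariant_def
proof (intro ballI)
  fix \<theta> :: real and a assume a: "a \<in> A_alg N"
  have bd: "d b \<in> bounded_operators" if "b \<in> A_alg N" for b
    using derivation_in_if_implements[OF \<beta> d] that A_cstar_closed(6)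
    by (auto simp: derivation_in_def)
  have "coord (blinfun_apply (d b) (basis_vec k)) i = coord (commutator n \<beta> b (basis_vec k)) i"
    if "b \<in> A_alg N" for b i k
    using d that by (simp add: implements_iff basis_span_basis_vec)
  \<comment> \<open>Undoing the rotation removes the phase theta (i - k) and leaves -n
    theta.\<close>
  moreover have "cis (- \<theta> * (real i - real k)) * (cis (\<theta> * (real i - real k - of_int n)) * z) =
      cis (- (of_int n * \<theta>)) * z" for i k z
    unfolding mult.assoc[symmetric] cis_mult
    by (rule arg_cong[where f = "\<lambda>t. cis t * z"]) (simp add: algebra_simps)
  ultimately show "rho (- \<theta>) (d (rho \<theta> a)) = scaleC_op (exp (- \<i> * of_int n * of_real \<theta>)) (d a)"
    unfolding exp_minus_ii_eq_cis using a rho_A_alg[OF a] bd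
    by (intro eq_on_basis_vec)
      (simp_all add: rho_bounded_operators bounded_operators_closed coord_rho_basis
        coord_commutator_rho[OF a] blinfun_apply_scaleC_op coord_scaleC)
qed

text \<open>Chooses, for each \<open>a\<close> in \<open>A_alg\<close>, the operator provided by
  \<open>inner_on\<close>.\<close>

lemma exists_implements:
  assumes "beta_condition N n \<beta>"
  shows "\<exists>d. implements N n \<beta> d"
  using inner_on_beta_condition[OF assms] unfolding inner_on_def implements_iff by metis

section \<open>Covariant derivations are implemented by commutators\<close>

definition matrix_unit :: "nat \<Rightarrow> operator" where
  "matrix_unit i = op_power shift i o\<^sub>L (id_blinfun - (shift o\<^sub>L adj shift))"

lemma matrix_unit_A_alg: "matrix_unit i \<in> A_alg N"
  unfolding matrix_unit_def
  by (intro A_alg_closed star_subalgebra_diff[OF star_subalgebra_A_alg] op_power_A_alg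
      id_A_alg shift_A_alg)

lemma blinfun_apply_matrix_unit:
  "blinfun_apply (matrix_unit i) x = coord x 0 *\<^sub>C basis_vec i"
  by (rule ell2_eqI)
    (auto simp: matrix_unit_def blinfun_apply_op_power coord_shift_power blinfun.diff_left
      coord_minus coord_shift coord_adj_shift coord_scaleC coord_basis_vec split: nat.split)

text \<open>Additivity of \<open>d\<close> is assumed only on \<open>A_alg\<close>, so the induction
  must carry membership of the partial sums.\<close>

lemma derivation_in_sum:
  assumes d: "derivation_in N d" and f: "\<And>k. k \<in> F \<Longrightarrow> f k \<in> A_alg N"
  shows "(\<Sum>k\<in>F. f k) \<in> A_alg N \<and> d (\<Sum>k\<in>F. f k) = (\<Sum>k\<in>F. d (f k))"
proof -
  have "d 0 = 0"
    using d A_alg_closed(1) unfolding derivation_in_def by (metis add_cancel_left_right add.right_neutral)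
  then show ?thesis
    using f d by (induction F rule: infinite_finite_induct)
      (auto simp: derivation_in_def A_alg_closed)
qed

text \<open>Compares two expansions of \<open>d (a o\<^sub>L matrix_unit i)\<close> at E_0: by
  linearity over the finite column of \<open>a\<close>, and by the Leibniz rule.\<close>

lemma derivation_in_column:
  fixes i :: nat
  assumes d: "derivation_in N d" and a: "a \<in> A_alg N"
  defines "b \<equiv> \<lambda>i. blinfun_apply (d (matrix_unit i)) (basis_vec 0)"
  defines "c \<equiv> coord (blinfun_apply a (basis_vec i))"
  shows "blinfun_apply (d a) (basis_vec i) =
    (\<Sum>k\<in>{k. c k \<noteq> 0}. c k *\<^sub>C b k) - blinfun_apply a (b i)"
proof -
  define F where "F = {k. c k \<noteq> 0}"
  have fin: "finite F"
    using A_alg_basis_span[OF a basis_span_basis_vec, of i]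
    by (simp add: basis_span_iff F_def c_def)
  have sum_app: "blinfun_apply (\<Sum>k\<in>F. f k) x = (\<Sum>k\<in>F. blinfun_apply (f k) x)"
    for f :: "nat \<Rightarrow> operator" and x
    by (rule blinfun.sum_left)
  have col: "blinfun_apply a (basis_vec i) = (\<Sum>k\<in>F. c k *\<^sub>C basis_vec k)"
    by (rule ell2_eqI)
      (use fin in \<open>auto simp: coord_sum coord_scaleC coord_basis_vec if_distrib F_def c_def
        cong: if_cong\<close>)
  have "a o\<^sub>L matrix_unit i = (\<Sum>k\<in>F. scaleC_op (c k) (matrix_unit k))"
  proof (intro blinfun_eqI ell2_eqI)
    fix x j
    show "coord (blinfun_apply (a o\<^sub>L matrix_unit i) x) j =
        coord (blinfun_apply (\<Sum>k\<in>F. scaleC_op (c k) (matrix_unit k)) x) j"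
      by (simp add: blinfun_apply_matrix_unit bounded_operatorsD[OF A_alg_closed(6)[OF a]] col
          sum_app blinfun_apply_scaleC_op coord_scaleC coord_sum sum_distrib_left mult.left_commute)
  qed
  then have "d (a o\<^sub>L matrix_unit i) = (\<Sum>k\<in>F. scaleC_op (c k) (d (matrix_unit k)))"
    using derivation_in_sum[OF d, of F "\<lambda>k. scaleC_op (c k) (matrix_unit k)"] d
    by (simp add: matrix_unit_A_alg A_alg_closed derivation_in_def)
  moreover have "d (a o\<^sub>L matrix_unit i) = (d a o\<^sub>L matrix_unit i) + (a o\<^sub>L d (matrix_unit i))"
    using d a matrix_unit_A_alg by (simp add: derivation_in_def)
  ultimately have "blinfun_apply ((d a o\<^sub>L matrix_unit i) + (a o\<^sub>L d (matrix_unit i))) (basis_vec 0) =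
      blinfun_apply (\<Sum>k\<in>F. scaleC_op (c k) (d (matrix_unit k))) (basis_vec 0)"
    by simp
  moreover have "blinfun_apply (matrix_unit i) (basis_vec 0) = basis_vec i"
    by (rule ell2_eqI) (simp add: blinfun_apply_matrix_unit coord_basis_vec coord_scaleC)
  ultimately show ?thesis
    unfolding F_def[symmetric]
    by (simp add: blinfun.add_left sum_app blinfun_apply_scaleC_op b_def eq_diff_eq)
qed

text \<open>\<open>matrix_unit i\<close> is an eigenvector of every rotation, so covariance equates
  the entry with itself times a phase of angle (i + n - l) theta. One angle with a phase other than
  1 makes it vanish.\<close>

lemma covariant_matrix_unit:
  assumes d: "derivation_in N d" and cov: "covariant N n d" and l: "int l \<noteq> int i + n"
  shows "coord (blinfun_apply (d (matrix_unit i)) (basis_vec 0)) l = 0"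
proof -
  let ?c = "coord (blinfun_apply (d (matrix_unit i)) (basis_vec 0)) l"
  define m where "m = int i + n - int l"
  \<comment> \<open>at this angle the rotation factor \<open>exp (\<i> m \<theta>)\<close> is \<open>-1\<close>\<close>
  define \<theta> where "\<theta> = pi / \<bar>of_int m\<bar>"
  have m: "m \<noteq> 0" using l by (simp add: m_def)
  \<comment> \<open>Keeps the angle at most pi, inside the range where covariance is given.\<close>
  then have "\<bar>of_int m\<bar> \<ge> (1 :: real)" by linarith
  then have \<theta>: "\<theta> \<in> {0..<2 * pi}"
    unfolding \<theta>_def using pi_gt_zero by (auto simp: divide_simps)
  have bd: "d b \<in> bounded_operators" if "b \<in> A_alg N" for b
    using d that A_cstar_closed(6) by (auto simp: derivation_in_def)
  have "rho \<theta> (matrix_unit i) = scaleC_op (cis (\<theta> * i)) (matrix_unit i)"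
    by (rule eq_on_basis_vec)
      (auto simp: rho_bounded_operators bounded_operators_closed coord_rho_basis
        A_alg_closed(6)[OF matrix_unit_A_alg] blinfun_apply_scaleC_op blinfun_apply_matrix_unit
        coord_scaleC coord_basis_vec)
  then have "rho (- \<theta>) (scaleC_op (cis (\<theta> * i)) (d (matrix_unit i))) =
      scaleC_op (cis (- (of_int n * \<theta>))) (d (matrix_unit i))"
    using cov \<theta> d matrix_unit_A_alg[of i N] exp_minus_ii_eq_cis[of n \<theta>]
    unfolding covariant_def derivation_in_def by metis
  then have "coord (blinfun_apply (rho (- \<theta>) (scaleC_op (cis (\<theta> * i)) (d (matrix_unit i)))) (basis_vec 0)) l =
      coord (blinfun_apply (scaleC_op (cis (- (of_int n * \<theta>))) (d (matrix_unit i))) (basis_vec 0)) l"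
    by simp
  then have "cis (- (\<theta> * l)) * (cis (\<theta> * i) * ?c) = cis (- (of_int n * \<theta>)) * ?c"
    by (simp add: coord_rho_basis bd matrix_unit_A_alg bounded_operators_closed
        blinfun_apply_scaleC_op coord_scaleC)
  then have "cis (of_int n * \<theta>) * (cis (- (\<theta> * l)) * (cis (\<theta> * i) * ?c)) =
      cis (of_int n * \<theta>) * (cis (- (of_int n * \<theta>)) * ?c)"
    by simp
  then have "cis (of_int n * \<theta> + - (\<theta> * l) + \<theta> * i) * ?c = ?c"
    by (simp only: cis_mult flip: mult.assoc) (simp add: cis_mult algebra_simps)
  moreover have "of_int n * \<theta> + - (\<theta> * l) + \<theta> * i = of_int m * \<theta>"
    by (simp add: m_def algebra_simps)
  moreover have "cis (of_int m * \<theta>) = - 1"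
    using m by (cases "m > 0") (auto simp: \<theta>_def complex_eq_iff)
  ultimately show ?thesis by simp
qed

lemma covariant_derivation_implements:
  assumes d: "derivation_in N d" and cov: "covariant N n d"
  shows "\<exists>\<beta>. implements N n \<beta> d"
proof -
  define b where "b i = blinfun_apply (d (matrix_unit i)) (basis_vec 0)" for i
  \<comment> \<open>Reads off the one entry of each column that can be nonzero. For n < 0 the value
    at k belongs to the column of E_{k-n}, which is sent to a multiple of E_k.\<close>
  define \<beta> where "\<beta> k = (if n \<ge> 0 then coord (b k) (k + nat n) else coord (b (k + nat (- n))) k)" for k
  have b: "b i = twisted_diag n \<beta> (basis_vec i)" for i
  proof (rule ell2_eqI)
    fix l
    show "coord (b i) l = coord (twisted_diag n \<beta> (basis_vec i)) l"
    proof (cases "int l = int i + n")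
      case True
      then show ?thesis
        by (auto simp: coord_twisted_diag basis_span_basis_vec coord_basis_vec \<beta>_def)
    next
      case False
      then have "coord (b i) l = 0"
        unfolding b_def using covariant_matrix_unit[OF d cov] by blast
      then show ?thesis
        using False by (cases "n \<ge> 0")
          (auto simp: coord_twisted_diag basis_span_basis_vec coord_basis_vec)
    qed
  qed
  have "blinfun_apply (d a) x = commutator n \<beta> a x" if a: "a \<in> A_alg N" and "x \<in> basis_span" for a x
  proof -
    have "blinfun_apply (d a) (basis_vec i) = commutator n \<beta> a (basis_vec i)" for i
    proof -
      let ?c = "coord (blinfun_apply a (basis_vec i))"
      let ?F = "{k. ?c k \<noteq> 0}"
      have "finite ?F"
        using A_alg_basis_span[OF a basis_span_basis_vec, of i] by (simp add: basis_span_iff)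
      then have "blinfun_apply a (basis_vec i) = (\<Sum>k\<in>?F. ?c k *\<^sub>C basis_vec k)"
        by (intro ell2_eqI)
          (auto simp: coord_sum coord_scaleC coord_basis_vec if_distrib cong: if_cong)
      then have "twisted_diag n \<beta> (blinfun_apply a (basis_vec i)) =
          twisted_diag n \<beta> (\<Sum>k\<in>?F. ?c k *\<^sub>C basis_vec k)"
        by (rule arg_cong)
      also have "\<dots> = (\<Sum>k\<in>?F. ?c k *\<^sub>C b k)"
        by (simp add: twisted_diag_sum twisted_diag_scaleC basis_span_scaleC basis_span_basis_vec b)
      finally show ?thesis
        using derivation_in_column[OF d a, of i, folded b_def] by (simp add: commutator_def b)
    qed
    moreover have "d a \<in> bounded_operators"
      using d a A_cstar_closed(6) by (auto simp: derivation_in_def)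
    ultimately show ?thesis using commutator_eq_iff_basis[OF _ a] \<open>x \<in> basis_span\<close> by blast
  qed
  then show ?thesis by (auto simp: implements_iff)
qed

section \<open>Recovering the condition on the sequence from the commutators\<close>

lemma diag_mem_if_commutators:
  assumes comm: "\<And>a. a \<in> A_alg N \<Longrightarrow> inner_on N n \<beta> a"
    and j: "j > 0" "dvd_supernatural j N" "\<not> int j dvd n"
  shows "diag_mem N \<beta>"
proof -
  \<comment> \<open>Powers of a primitive j-th root of unity, with integer exponents so that
    \<open>w n\<close> makes sense for negative n.\<close>
  define w where "w k = cis (2 * pi * of_int k / of_nat j)" for k :: int
  have w_add: "w (k + l) = w k * w l" for k l
    by (simp add: w_def cis_mult add_divide_distrib distrib_left)
  have w_1: "w n \<noteq> 1"
  proof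
    assume "w n = 1"
    then obtain m :: int where "2 * pi * of_int n / of_nat j = of_int m * (2 * pi)"
      unfolding w_def cis_eq_1_iff by blast
    then have "real_of_int n = of_int (m * int j)" using j(1) by (simp add: field_simps)
    then have "n = m * int j" by (simp only: of_int_eq_iff)
    then show False using j(3) by simp
  qed
  have per: "w (int j + k) = w k" for k
    using j(1) by (simp add: w_add) (simp add: w_def)
  have bound: "cmod (w k) \<le> 1" "cmod (cnj (w k)) \<le> 1" for k
    by (simp_all add: w_def)
  have w_cnj: "cnj (w k) * w k = 1" for k
    by (simp add: w_def cis_cnj cis_mult)
  let ?a = "bdiag (\<lambda>k. w (int k))" and ?a' = "bdiag (\<lambda>k. cnj (w (int k)))"
  have a: "?a \<in> A_alg N" "?a' \<in> A_alg N"
    using j per by (auto intro!: bdiag_periodic_A_alg simp: add.commute)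
  obtain T where T: "T \<in> A_cstar N"
    "\<And>x. x \<in> basis_span \<Longrightarrow> blinfun_apply T x = commutator n \<beta> ?a x"
    using comm[OF a(1)] by (auto simp: inner_on_def)
  \<comment> \<open>Since B moves indices by n, T is (1 - w n) B w(K). The factors cancel the
    scalar, the phases and the power of the shift, the last by U^* U = I, applied on the left for n
    >= 0 and on the right for n < 0.\<close>
  define D where "D = scaleC_op (1 / (1 - w n))
    (if n \<ge> 0 then ?a' o\<^sub>L op_power (adj shift) (nat n) o\<^sub>L T
     else T o\<^sub>L ?a' o\<^sub>L op_power shift (nat (- n)))"
  have gen: "op_power shift k \<in> A_cstar N" "op_power (adj shift) k \<in> A_cstar N"
    "?a' \<in> A_cstar N" for k
    using op_power_A_alg[of _ N] shift_A_alg A_alg_closed(5) a A_alg_subset_A_cstar[of N] by blast+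
  show ?thesis
  proof (rule diag_memI)
    show "D \<in> A_cstar N"
      unfolding D_def by (auto intro!: A_cstar_closed(3,4) gen T)
    fix k i
    show "coord (blinfun_apply D (basis_vec k)) i = (if i = k then \<beta> k else 0)"
    proof (cases "n \<ge> 0")
      case True
      have "coord (blinfun_apply D (basis_vec k)) i = 1 / (1 - w n) *
          (if i = k then cnj (w (int i)) * (\<beta> i * w (int i) - w (int i + n) * \<beta> i) else 0)"
        using True by (simp add: D_def blinfun_apply_scaleC_op coord_scaleC
            blinfun_apply_op_power coord_adj_shift_power T(2) basis_span_basis_vec commutator_def
            coord_minus coord_twisted_diag basis_span_bdiag[OF bound(1)] coord_bdiag[OF bound(1)]
            coord_bdiag[OF bound(2)] coord_basis_vec)
      also have "cnj (w (int i)) * (\<beta> i * w (int i) - w (int i + n) * \<beta> i) =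
          (cnj (w (int i)) * w (int i)) * ((1 - w n) * \<beta> i)"
        by (simp add: w_add algebra_simps)
      finally show ?thesis using w_1 by (auto simp: w_cnj)
    next
      case False
      define m where "m = nat (- n)"
      then have m: "n = - int m" using False by simp
      have U: "(blinfun_apply shift ^^ m) (basis_vec k) = basis_vec (k + m)"
        by (rule ell2_eqI) (auto simp: coord_shift_power coord_basis_vec)
      have "coord (blinfun_apply D (basis_vec k)) i = 1 / (1 - w n) *
          (if i = k then cnj (w (int i + int m)) *
            (\<beta> i * w (int i + int m) - w (int i) * \<beta> i) else 0)"
        using False by (auto simp: D_def m_def[symmetric] U blinfun_apply_scaleC_op coord_scaleC
            blinfun_apply_op_power T(2) basis_span_basis_vec commutator_def
            coord_minus coord_twisted_diag basis_span_bdiag[OF bound(1)] coord_bdiag[OF bound(1)]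
            basis_span_bdiag[OF bound(2)] coord_bdiag[OF bound(2)] coord_basis_vec
            algebra_simps diff_divide_distrib)
      \<comment> \<open>Exposes the factor that the conjugate phase cancels.\<close>
      also have "w (int i) = w (int i + int m) * w n"
        by (simp add: m flip: w_add)
      also have "cnj (w (int i + int m)) *
            (\<beta> i * w (int i + int m) - w (int i + int m) * w n * \<beta> i) =
          (cnj (w (int i + int m)) * w (int i + int m)) * ((1 - w n) * \<beta> i)"
        by (simp add: algebra_simps)
      finally show ?thesis using w_1 by (auto simp: w_cnj)
    qed
  qed
qed

lemma diag_mem_backward_diff_if_commutators:
  assumes comm: "\<And>a. a \<in> A_alg N \<Longrightarrow> inner_on N n \<beta> a"
  shows "diag_mem N (backward_diff \<beta>)"
proof -
  obtain T where T: "T \<in> A_cstar N"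
    "\<And>x. x \<in> basis_span \<Longrightarrow> blinfun_apply T x = commutator n \<beta> shift x"
    using comm[OF shift_A_alg] by (auto simp: inner_on_def)
  \<comment> \<open>For n >= 0, T is U^n times the sought diagonal operator times U. Stripping the
    shifts loses the entry at E_0, which is \<open>\<beta> 0\<close>; \<open>matrix_unit 0\<close>,
    the projection onto E_0, restores it. For n < 0 a power of U on the right suffices.\<close>
  define D where "D = (if n \<ge> 0
    then (shift o\<^sub>L op_power (adj shift) (nat n + 1) o\<^sub>L T o\<^sub>L adj shift)
      + scaleC_op (\<beta> 0) (matrix_unit 0)
    else T o\<^sub>L op_power shift (nat (- n) - 1))"
  have gen: "shift \<in> A_cstar N" "adj shift \<in> A_cstar N" "op_power shift k \<in> A_cstar N"
    "op_power (adj shift) k \<in> A_cstar N" "matrix_unit k \<in> A_cstar N" for k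
    using op_power_A_alg[of _ N] shift_A_alg A_alg_closed(5) matrix_unit_A_alg
      A_alg_subset_A_cstar[of N] by blast+
  have span: "(blinfun_apply shift ^^ m) (basis_vec k) = basis_vec (k + m)" for k m
    by (induction m) (simp_all add: shift_basis_vec)
  show ?thesis
  proof (rule diag_memI)
    show "D \<in> A_cstar N"
      unfolding D_def by (auto intro!: A_cstar_closed(2,3,4) gen T)
    fix k i
    show "coord (blinfun_apply D (basis_vec k)) i = (if i = k then backward_diff \<beta> k else 0)"
      by (auto simp: D_def blinfun_apply_op_power span blinfun.add_left coord_add
          blinfun_apply_scaleC_op coord_scaleC blinfun_apply_matrix_unit coord_basis_vec
          coord_shift coord_adj_shift_power T(2) basis_span_basis_vec basis_span_adj_shift
          commutator_def coord_minus coord_twisted_diag basis_span_shift coord_adj_shift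
          backward_diff_def split: nat.split simp del: funpow.simps)
  qed
qed

lemma beta_condition_if_implements:
  assumes d: "derivation_in N d" and imp: "implements N n \<beta> d"
  shows "beta_condition N n \<beta>"
proof -
  have inner: "inner_on N n \<beta> a" if "a \<in> A_alg N" for a
    using that d imp by (auto simp: inner_on_def implements_iff derivation_in_def)
  then show ?thesis
    unfolding beta_condition_iff
    using diag_mem_if_commutators[OF inner] diag_mem_backward_diff_if_commutators[OF inner] by auto
qed

section \<open>Uniqueness\<close>

text \<open>The increments of \<open>\<beta>\<close> are entries of [B, U]. At least one of
  \<open>nat n\<close> and \<open>nat (- n)\<close> is 0, so one formula serves both signs.\<close>

lemma coord_commutator_shift:
  "coord (commutator n \<beta> shift (basis_vec (k + nat (- n)))) (Suc k + nat n) = \<beta> (Suc k) - \<beta> k"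
  by (auto simp: commutator_def coord_minus shift_basis_vec coord_shift coord_twisted_diag
      basis_span_basis_vec coord_basis_vec)

lemma implements_commutator_eq:
  assumes "implements N n \<beta> d" "implements N n \<beta>' d" "a \<in> A_alg N"
  shows "commutator n \<beta> a (basis_vec k) = commutator n \<beta>' a (basis_vec k)"
  using assms basis_span_basis_vec by (metis implements_iff)

lemma implements_differ_by_constant:
  assumes "implements N n \<beta> d" "implements N n \<beta>' d"
  shows "\<beta>' k - \<beta> k = \<beta>' 0 - \<beta> 0"
proof (induction k)
  case (Suc k)
  have eq: "\<beta> (Suc k) - \<beta> k = \<beta>' (Suc k) - \<beta>' k"
    using implements_commutator_eq[OF assms shift_A_alg] coord_commutator_shift by metis
  have "\<beta>' (Suc k) - \<beta> (Suc k) = (\<beta>' (Suc k) - \<beta>' k) - (\<beta> (Suc k) - \<beta> k) + (\<beta>' k - \<beta> k)"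
    by simp
  then show ?case using Suc eq by simp
qed simp

text \<open>The free constant is fixed at the boundary: U^* E_0 = 0 leaves
  \<open>- \<gamma> 0\<close> as an entry of [B, U^*] for n > 0, and for n < 0 the operator B kills
  E_{-n-1}, leaving \<open>\<gamma> 0\<close> in [B, U].\<close>

lemma implements_unique:
  assumes "implements N n \<beta> d" "implements N n \<beta>' d" "n \<noteq> 0"
  shows "\<beta>' = \<beta>"
proof -
  note eq = implements_commutator_eq[OF assms(1,2)]
  have "\<beta>' 0 = \<beta> 0"
  proof (cases "n > 0")
    case True
    then have "coord (commutator n \<gamma> (adj shift) (basis_vec 0)) (nat n - 1) = - \<gamma> 0" for \<gamma>
      by (auto simp: commutator_def coord_minus coord_adj_shift coord_twisted_diag
          basis_span_basis_vec basis_span_adj_shift coord_basis_vec)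
    then show ?thesis using eq[OF A_alg_closed(5)[OF shift_A_alg]] by (metis neg_equal_iff_equal)
  next
    case False
    then have "Suc (nat (- n) - 1) = nat (- n)" using assms(3) by linarith
    then have "coord (commutator n \<gamma> shift (basis_vec (nat (- n) - 1))) 0 = \<gamma> 0" for \<gamma>
      using False assms(3)
      by (auto simp: commutator_def coord_minus shift_basis_vec coord_shift coord_twisted_diag
          basis_span_basis_vec coord_basis_vec)
    then show ?thesis using eq[OF shift_A_alg] by metis
  qed
  then show ?thesis using implements_differ_by_constant[OF assms(1,2)] by (simp add: fun_eq_iff)
qed

text \<open>For n = 0 the constant adds c I to B, which commutes with complex linear
  operators.\<close>

lemma implements_zero_add_const:
  assumes "implements N 0 \<beta> d"
  shows "implements N 0 (\<lambda>k. \<beta> k + c) d"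
proof -
  have tw: "twisted_diag 0 (\<lambda>k. \<beta> k + c) x = twisted_diag 0 \<beta> x + c *\<^sub>C x" if "x \<in> basis_span" for x
    by (rule ell2_eqI) (simp add: coord_twisted_diag that coord_add coord_scaleC algebra_simps)
  have "commutator 0 (\<lambda>k. \<beta> k + c) a x = commutator 0 \<beta> a x"
    if "a \<in> A_alg N" "x \<in> basis_span" for a x
    using that bounded_operatorsD[OF A_alg_closed(6)[OF that(1)]]
    by (simp add: commutator_def tw A_alg_basis_span blinfun.add_right)
  then show ?thesis using assms by (simp add: implements_iff)
qed

text \<open>\<open>implements\<close> is a relation, so the converse states both that some
  \<open>d\<close> satisfies the formula and that every such \<open>d\<close> is a covariant
  derivation.\<close>

theorem theorem3p4:
  fixes N :: supernatural and n :: int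
  shows "(\<forall>d. derivation_in N d \<and> covariant N n d \<longrightarrow>
           (\<exists>\<beta>. implements N n \<beta> d \<and> beta_condition N n \<beta> \<and>
              (n \<noteq> 0 \<longrightarrow> (\<forall>\<beta>'. implements N n \<beta>' d \<longrightarrow> \<beta>' = \<beta>)) \<and>
              (n = 0 \<longrightarrow> (\<forall>\<beta>'. implements N n \<beta>' d \<longleftrightarrow> (\<exists>c. \<beta>' = (\<lambda>k. \<beta> k + c)))))) \<and>
         (\<forall>\<beta>. beta_condition N n \<beta> \<longrightarrow>
           (\<exists>d. implements N n \<beta> d) \<and>
           (\<forall>d. implements N n \<beta> d \<longrightarrow> derivation_in N d \<and> covariant N n d))"
proof (intro conjI allI impI)
  fix d assume "derivation_in N d \<and> covariant N n d"
  then have d: "derivation_in N d" and cov: "covariant N n d" by auto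
  then obtain \<beta> where \<beta>: "implements N n \<beta> d" using covariant_derivation_implements by blast
  \<comment> \<open>The additive constant is the difference of the two sequences at 0.\<close>
  have "\<beta>' = (\<lambda>k. \<beta> k + (\<beta>' 0 - \<beta> 0))" if "implements N n \<beta>' d" for \<beta>'
    using implements_differ_by_constant[OF \<beta> that]
    by (intro ext) (metis add.commute diff_add_cancel)
  moreover have "implements N n (\<lambda>k. \<beta> k + c) d" if "n = 0" for c
    using implements_zero_add_const \<beta> that by simp
  ultimately have "implements N n \<beta>' d \<longleftrightarrow> (\<exists>c. \<beta>' = (\<lambda>k. \<beta> k + c))" if "n = 0" for \<beta>'
    using that by metis
  then show "\<exists>\<beta>. implements N n \<beta> d \<and> beta_condition N n \<beta> \<and>
      (n \<noteq> 0 \<longrightarrow> (\<forall>\<beta>'. implements N n \<beta>' d \<longrightarrow> \<beta>' = \<beta>)) \<and>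
      (n = 0 \<longrightarrow> (\<forall>\<beta>'. implements N n \<beta>' d \<longleftrightarrow> (\<exists>c. \<beta>' = (\<lambda>k. \<beta> k + c))))"
    using \<beta> beta_condition_if_implements[OF d \<beta>] implements_unique[OF \<beta>]
    by (intro exI[of _ \<beta>]) simp
qed (auto intro: exists_implements derivation_in_if_implements covariant_if_implements)

end
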